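(* Let $\rho,E,I,m,\varkappa,l$ be positive real numbers and $l_0\in(0,l)$. Let $\omega_1<\omega_2<\dots$ be the positive solutions of the characteristic equation $\Delta(\omega)=0$, enumerated in increasing order, where $\Delta$ is the function defined in the context. Let $r\in\mathbb N$, let $(c_{sj})_{s=1,\dots,r;\ j\ge1}$ be real numbers with $\sum_{j=1}^\infty c_{sj}^2<\infty$ for every $s$, let $\gamma_1,\dots,\gamma_r>0$ be arbitrary, and let $A$, $C$, $F$ be the operators defined from these data in the context; in particular $F$ has components $f_{js}=\gamma_sc_{sj}$, $g_{js}=0$. If for each $j\in\mathbb N$ there exists $s\in\{1,\dots,r\}$ such that $c_{sj}\ne0$, then the trivial solution $e=0$ of the system $\dot e(t)=(A-FC)e(t)$ in $H$ is asymptotically stable.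
   Context: Characteristic function: for $\omega>0$ put $\mu=\left(\frac{\rho\,\omega^2}{EI}\right)^{1/4}>0$ and $$\begin{aligned}\Delta(\omega)=\ &\frac{m}{4\mu\rho}\Big\{(\cosh\mu(l-2l_0)-\cosh\mu l)\sin\mu l+(\cos\mu(l-2l_0)-\cos\mu l)\sinh\mu l\Big\}-\frac{\sin\mu l\,\sinh\mu l}{\mu^2}\\&+\frac{\varkappa}{4EI\mu^5}\Big\{(\cosh\mu l-\cosh\mu(l-2l_0))\sin\mu l-(\cos\mu(l-2l_0)-\cos\mu l)\sinh\mu l\Big\}.\end{aligned}$$ This is the characteristic equation of the spectral problem for a hinged beam with an attached mass-spring system at $x=l_0$: $W''''=\omega^2\frac{\rho}{EI}W$ on $(0,l)\setminus\{l_0\}$, $W(0)=W(l)=0$, $W''(0)=W''(l)=0$, $W\in C^2[0,l]$, $W'''(l_0-0)-W'''(l_0+0)=\frac{\varkappa-\omega^2m}{EI}W(l_0)$. $\ell^2$ is the real Hilbert space of square-summable real sequences and $H=\ell^2\times\ell^2$, with elements written $z=\begin{pmatrix}\xi\\ \eta\end{pmatrix}$ and inner product $\left\langle \begin{pmatrix}\xi\\ \eta\end{pmatrix},\begin{pmatrix}\tilde\xi\\ \tilde\eta\end{pmatrix}\right\rangle_H=\sum_{j=1}^\infty(\xi_j\tilde\xi_j+\eta_j\tilde\eta_j)$. With $\Omega=\operatorname{diag}(\omega_1,\omega_2,\dots)$, the operator $A:D(A)\to H$ is $A\begin{pmatrix}\xi\\ \eta\end{pmatrix}=\begin{pmatrix}\Omega\eta\\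 -\Omega\xi\end{pmatrix}$ with domain $D(A)=\left\{\begin{pmatrix}\xi\\ \eta\end{pmatrix}\in H:\ \sum_{j=1}^\infty\omega_j^2(\xi_j^2+\eta_j^2)<\infty\right\}$. The output operator $C:H\to\mathbb R^r$ is $C\begin{pmatrix}\xi\\ \eta\end{pmatrix}=C_1\xi$, where $(C_1\xi)_s=\sum_{j=1}^\infty c_{sj}\xi_j$, $s=1,\dots,r$. The operator $F:\mathbb R^r\to H$ is $Fy=\begin{pmatrix}fy\\ gy\end{pmatrix}$, where $f,g:\mathbb R^r\to\ell^2$ are given by $(fy)_j=\sum_{s=1}^r f_{js}y_s$, $(gy)_j=\sum_{s=1}^r g_{js}y_s$ with $f_{js}=\gamma_sc_{sj}$ and $g_{js}=0$. The system $\dot e=(A-FC)e$, with $A-FC$ defined on $D(A)$, is the error dynamics ($e=z-\bar z$) of the observer $\dot{\bar z}=(A-FC)\bar z+Bu+Fy$ for the control system $\dot z=Az+Bu$, $y=Cz$. Its solution with $e(0)=e_0\in H$ is the (mild) solution $e(t)=e^{t(A-FC)}e_0$, $t\ge0$. Asymptotic stability of $e=0$ means: $e=0$ is stable in the sense of Lyapunov (for every $\varepsilon>0$ there is $\delta>0$ such that $\|e(0)\|_H<\delta$ implies $\|e(t)\|_H<\varepsilon$ for all $t\ge0$), and $\|e(t)\|_H\to0$ as $t\to+\infty$ for every $e(0)\in H$. *)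

theory Defs
  imports "HOL-Analysis.Analysis"
begin

section \<open>The real Hilbert space of square-summable sequences\<close>

text \<open>All sequences are indexed from 0, so index \<open>j\<close> here is index \<open>j + 1\<close> in
  the usual one-based notation.\<close>

typedef ell2 = "{x :: nat \<Rightarrow> real. summable (\<lambda>j. (x j)\<^sup>2)}"
  morphisms coord Ell2
  by (rule exI[of _ "\<lambda>_. 0"]) simp

lemma summable_coord_sq: "summable (\<lambda>j. (coord x j)\<^sup>2)"
  using coord[of x] by simp

lemma coord_Ell2: "summable (\<lambda>j. (x j)\<^sup>2) \<Longrightarrow> coord (Ell2 x) = x"
  by (simp add: Ell2_inverse)

lemma ell2_eqI: "(\<And>j. coord x j = coord y j) \<Longrightarrow> x = y"
  by (metis coord_inject ext)

lemma summable_mult_sq: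
  fixes a b :: "nat \<Rightarrow> real"
  assumes "summable (\<lambda>j. (a j)\<^sup>2)" "summable (\<lambda>j. (b j)\<^sup>2)"
  shows "summable (\<lambda>j. a j * b j)"
proof (rule summable_comparison_test'[where N = 0])
  show "summable (\<lambda>j. (a j)\<^sup>2 + (b j)\<^sup>2)"
    by (intro summable_add assms)
  fix j :: nat
  have "0 \<le> (\<bar>a j\<bar> - \<bar>b j\<bar>)\<^sup>2" by simp
  then have "2 * (\<bar>a j\<bar> * \<bar>b j\<bar>) \<le> (a j)\<^sup>2 + (b j)\<^sup>2"
    by (simp add: power2_diff)
  moreover have "0 \<le> \<bar>a j\<bar> * \<bar>b j\<bar>" by simp
  ultimately show "norm (a j * b j) \<le> (a j)\<^sup>2 + (b j)\<^sup>2"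
    unfolding real_norm_def abs_mult by linarith
qed

lemma summable_add_sq:
  fixes a b :: "nat \<Rightarrow> real"
  assumes "summable (\<lambda>j. (a j)\<^sup>2)" "summable (\<lambda>j. (b j)\<^sup>2)"
  shows "summable (\<lambda>j. (a j + b j)\<^sup>2)"
  using summable_add[OF summable_add[OF assms] summable_mult[OF summable_mult_sq[OF assms], of 2]]
  by (simp add: power2_sum algebra_simps)

lemma summable_scale_sq:
  fixes a :: "nat \<Rightarrow> real"
  assumes "summable (\<lambda>j. (a j)\<^sup>2)"
  shows "summable (\<lambda>j. (t * a j)\<^sup>2)"
  using summable_mult[OF assms, of "t\<^sup>2"] by (simp add: power_mult_distrib)

instantiation ell2 :: real_inner
begin

definition zero_ell2 :: ell2 where "0 = Ell2 (\<lambda>_. 0)"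
definition plus_ell2 :: "ell2 \<Rightarrow> ell2 \<Rightarrow> ell2"
  where "x + y = Ell2 (\<lambda>j. coord x j + coord y j)"
definition uminus_ell2 :: "ell2 \<Rightarrow> ell2"
  where "- x = Ell2 (\<lambda>j. - coord x j)"
definition minus_ell2 :: "ell2 \<Rightarrow> ell2 \<Rightarrow> ell2"
  where "x - y = Ell2 (\<lambda>j. coord x j - coord y j)"
definition scaleR_ell2 :: "real \<Rightarrow> ell2 \<Rightarrow> ell2"
  where "t *\<^sub>R x = Ell2 (\<lambda>j. t * coord x j)"
definition inner_ell2 :: "ell2 \<Rightarrow> ell2 \<Rightarrow> real"
  where "x \<bullet> y = (\<Sum>j. coord x j * coord y j)"
definition norm_ell2 :: "ell2 \<Rightarrow> real"
  where "norm x = sqrt (x \<bullet> x)" for x :: ell2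
definition dist_ell2 :: "ell2 \<Rightarrow> ell2 \<Rightarrow> real"
  where "dist x y = norm (x - y)" for x y :: ell2
definition sgn_ell2 :: "ell2 \<Rightarrow> ell2"
  where "sgn x = inverse (norm x) *\<^sub>R x" for x :: ell2
definition uniformity_ell2 :: "(ell2 \<times> ell2) filter"
  where "uniformity = (INF e\<in>{0<..}. principal {(x, y :: ell2). dist x y < e})"
definition open_ell2 :: "ell2 set \<Rightarrow> bool"
  where "open U = (\<forall>x\<in>U. \<forall>\<^sub>F (x', y) in uniformity. x' = x \<longrightarrow> y \<in> U)" for U :: "ell2 set"

lemma coord_zero [simp]: "coord 0 j = 0"
  by (simp add: zero_ell2_def coord_Ell2)

lemma coord_plus [simp]: "coord (x + y) j = coord x j + coord y j"
  by (simp add: plus_ell2_def coord_Ell2 summable_add_sq summable_coord_sq)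

lemma coord_uminus [simp]: "coord (- x) j = - coord x j"
  by (simp add: uminus_ell2_def coord_Ell2 summable_coord_sq)

lemma coord_minus [simp]: "coord (x - y) j = coord x j - coord y j"
  using summable_add_sq[OF summable_coord_sq[of x], of "\<lambda>j. - coord y j"]
  by (simp add: minus_ell2_def coord_Ell2 summable_coord_sq)

lemma coord_scaleR [simp]: "coord (t *\<^sub>R x) j = t * coord x j"
  by (simp add: scaleR_ell2_def coord_Ell2 summable_scale_sq summable_coord_sq)

lemma summable_coord_mult: "summable (\<lambda>j. coord x j * coord y j)"
  by (intro summable_mult_sq summable_coord_sq)

instance
proof
  fix x y z :: ell2 and s t :: real
  show "x \<bullet> y = y \<bullet> x"
    by (simp add: inner_ell2_def mult.commute)
  show "(x + y) \<bullet> z = x \<bullet> z + y \<bullet> z"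
    by (simp add: inner_ell2_def distrib_right suminf_add summable_coord_mult)
  show "(t *\<^sub>R x) \<bullet> y = t * (x \<bullet> y)"
    by (simp add: inner_ell2_def mult.assoc suminf_mult summable_coord_mult)
  show "0 \<le> x \<bullet> x"
    by (simp add: inner_ell2_def suminf_nonneg summable_coord_mult)
  have "(x \<bullet> x = 0) = (\<forall>j. coord x j * coord x j = 0)"
    unfolding inner_ell2_def by (intro suminf_eq_zero_iff summable_coord_mult) simp
  also have "\<dots> = (x = 0)"
    by (auto intro: ell2_eqI)
  finally show "(x \<bullet> x = 0) = (x = 0)" .
qed (auto intro!: ell2_eqI simp: algebra_simps norm_ell2_def dist_ell2_def sgn_ell2_def
      uniformity_ell2_def open_ell2_def)

end

lemma norm_ell2_sq: "(norm x)\<^sup>2 = (\<Sum>j. (coord x j)\<^sup>2)" for x :: ell2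
  unfolding power2_norm_eq_inner inner_ell2_def by (simp add: power2_eq_square)

lemma sum_coord_sq_le: "(\<Sum>j<k. (coord x j)\<^sup>2) \<le> (norm x)\<^sup>2" for x :: ell2
  unfolding norm_ell2_sq by (intro sum_le_suminf summable_coord_sq) auto

lemma abs_coord_le: "\<bar>coord x j\<bar> \<le> norm x" for x :: ell2
proof -
  have "(coord x j)\<^sup>2 \<le> (\<Sum>i<Suc j. (coord x i)\<^sup>2)"
    by (simp add: sum_nonneg)
  also have "\<dots> \<le> (norm x)\<^sup>2" by (rule sum_coord_sq_le)
  finally show ?thesis by (simp add: abs_le_square_iff[symmetric])
qed

instance ell2 :: complete_space
proof
  fix X :: "nat \<Rightarrow> ell2"
  assume X: "Cauchy X"
  have "Cauchy (\<lambda>n. coord (X n) j)" for j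
  proof (rule metric_CauchyI)
    fix e :: real assume "e > 0"
    then obtain N where N: "\<forall>m\<ge>N. \<forall>n\<ge>N. dist (X m) (X n) < e"
      using metric_CauchyD[OF X] by blast
    have "dist (coord (X m) j) (coord (X n) j) < e" if "m \<ge> N" "n \<ge> N" for m n
    proof -
      have "dist (coord (X m) j) (coord (X n) j) \<le> dist (X m) (X n)"
        using abs_coord_le[of "X m - X n" j] by (simp add: dist_norm)
      then show ?thesis using N that by (meson le_less_trans)
    qed
    then show "\<exists>N. \<forall>m\<ge>N. \<forall>n\<ge>N. dist (coord (X m) j) (coord (X n) j) < e" by blast
  qed
  then have "\<exists>y. \<forall>j. (\<lambda>n. coord (X n) j) \<longlonglongrightarrow> y j"
    using choice[of "\<lambda>j L. (\<lambda>n. coord (X n) j) \<longlonglongrightarrow> L"]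
    by (simp add: Cauchy_convergent_iff convergent_def)
  then obtain y where y: "\<And>j. (\<lambda>n. coord (X n) j) \<longlonglongrightarrow> y j" by blast
  have part: "\<exists>N. \<forall>m\<ge>N. \<forall>k. (\<Sum>j<k. (coord (X m) j - y j)\<^sup>2) \<le> e\<^sup>2" if "e > 0" for e :: real
  proof -
    obtain N where N: "\<forall>m\<ge>N. \<forall>n\<ge>N. dist (X m) (X n) < e"
      using metric_CauchyD[OF X \<open>e > 0\<close>] by blast
    have "(\<Sum>j<k. (coord (X m) j - y j)\<^sup>2) \<le> e\<^sup>2" if "m \<ge> N" for m k
    proof (rule LIMSEQ_le_const2)
      show "(\<lambda>n. \<Sum>j<k. (coord (X m) j - coord (X n) j)\<^sup>2)
          \<longlonglongrightarrow> (\<Sum>j<k. (coord (X m) j - y j)\<^sup>2)"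
        by (intro tendsto_intros y)
      have "(\<Sum>j<k. (coord (X m) j - coord (X n) j)\<^sup>2) \<le> e\<^sup>2" if "n \<ge> N" for n
      proof -
        have "(\<Sum>j<k. (coord (X m) j - coord (X n) j)\<^sup>2) \<le> (norm (X m - X n))\<^sup>2"
          using sum_coord_sq_le[of "X m - X n" k] by simp
        also have "\<dots> \<le> e\<^sup>2"
          using N \<open>m \<ge> N\<close> that by (intro power_mono) (auto simp: dist_norm less_imp_le)
        finally show ?thesis .
      qed
      then show "\<exists>N. \<forall>n\<ge>N. (\<Sum>j<k. (coord (X m) j - coord (X n) j)\<^sup>2) \<le> e\<^sup>2" by blast
    qed
    then show ?thesis by blast
  qed
  have diff: "summable (\<lambda>j. (coord (X m) j - y j)\<^sup>2)"
    if "\<forall>k. (\<Sum>j<k. (coord (X m) j - y j)\<^sup>2) \<le> B" for m B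
  proof (rule bounded_imp_summable)
    show "(\<Sum>j\<le>k. (coord (X m) j - y j)\<^sup>2) \<le> B" for k
      using that by (metis lessThan_Suc_atMost)
  qed simp
  obtain M where M: "\<forall>m\<ge>M. \<forall>k. (\<Sum>j<k. (coord (X m) j - y j)\<^sup>2) \<le> 1\<^sup>2"
    using part[of 1] by auto
  have "summable (\<lambda>j. (coord (X M) j + - 1 * (coord (X M) j - y j))\<^sup>2)"
    by (intro summable_add_sq summable_scale_sq summable_coord_sq diff[of _ "1\<^sup>2"]) (use M in auto)
  then have ysum: "summable (\<lambda>j. (y j)\<^sup>2)" by simp
  have "X \<longlonglongrightarrow> Ell2 y"
  proof (rule metric_LIMSEQ_I)
    fix e :: real assume "e > 0"
    then obtain N where N: "\<forall>m\<ge>N. \<forall>k. (\<Sum>j<k. (coord (X m) j - y j)\<^sup>2) \<le> (e / 2)\<^sup>2"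
      using part[of "e / 2"] by auto
    have "dist (X m) (Ell2 y) < e" if "m \<ge> N" for m
    proof -
      have "(norm (X m - Ell2 y))\<^sup>2 = (\<Sum>j. (coord (X m) j - y j)\<^sup>2)"
        by (simp add: norm_ell2_sq coord_Ell2[OF ysum])
      also have "\<dots> \<le> (e / 2)\<^sup>2"
        using N that by (intro suminf_le_const diff[of _ "(e / 2)\<^sup>2"]) auto
      finally have "norm (X m - Ell2 y) \<le> e / 2"
        by (rule power2_le_imp_le) (use \<open>e > 0\<close> in simp)
      then show ?thesis using \<open>e > 0\<close> by (simp add: dist_norm)
    qed
    then show "\<exists>N. \<forall>m\<ge>N. dist (X m) (Ell2 y) < e" by blast
  qed
  then show "convergent X" by (auto simp: convergent_def)
qed

text \<open>The state space \<open>H = ell2 \<times> ell2\<close> carries the library's product inner product,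
  which is the sum of the two inner products.\<close>

type_synonym state = "ell2 \<times> ell2"

lemma inner_state: "(\<xi>, \<eta>) \<bullet> (\<xi>', \<eta>') = (\<Sum>j. coord \<xi> j * coord \<xi>' j + coord \<eta> j * coord \<eta>' j)"
  by (simp add: inner_Pair inner_ell2_def suminf_add summable_coord_mult)


section \<open>The characteristic function of the hinged beam\<close>

definition wave_number :: "real \<Rightarrow> real \<Rightarrow> real \<Rightarrow> real \<Rightarrow> real" where
  "wave_number \<rho> E I \<omega> = root 4 (\<rho> * \<omega>\<^sup>2 / (E * I))"

definition char_fun ::
    "real \<Rightarrow> real \<Rightarrow> real \<Rightarrow> real \<Rightarrow> real \<Rightarrow> real \<Rightarrow> real \<Rightarrow> real \<Rightarrow> real" where
  "char_fun \<rho> E I m \<kappa> l l\<^sub>0 \<omega> =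
    (let \<mu> = wave_number \<rho> E I \<omega> in
      m / (4 * \<mu> * \<rho>) *
        ((cosh (\<mu> * (l - 2 * l\<^sub>0)) - cosh (\<mu> * l)) * sin (\<mu> * l)
          + (cos (\<mu> * (l - 2 * l\<^sub>0)) - cos (\<mu> * l)) * sinh (\<mu> * l))
      - sin (\<mu> * l) * sinh (\<mu> * l) / \<mu>\<^sup>2
      + \<kappa> / (4 * E * I * \<mu> ^ 5) *
        ((cosh (\<mu> * l) - cosh (\<mu> * (l - 2 * l\<^sub>0))) * sin (\<mu> * l)
          - (cos (\<mu> * (l - 2 * l\<^sub>0)) - cos (\<mu> * l)) * sinh (\<mu> * l)))"


section \<open>The operators\<close>

text \<open>Outside its domain \<open>dom_A \<omega>\<close> the total function \<open>op_A \<omega>\<close> is unspecified.\<close>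

definition op_Omega :: "(nat \<Rightarrow> real) \<Rightarrow> ell2 \<Rightarrow> ell2" where
  "op_Omega \<omega> \<xi> = Ell2 (\<lambda>j. \<omega> j * coord \<xi> j)"

definition dom_A :: "(nat \<Rightarrow> real) \<Rightarrow> state set" where
  "dom_A \<omega> = {(\<xi>, \<eta>). summable (\<lambda>j. (\<omega> j)\<^sup>2 * ((coord \<xi> j)\<^sup>2 + (coord \<eta> j)\<^sup>2))}"

definition op_A :: "(nat \<Rightarrow> real) \<Rightarrow> state \<Rightarrow> state" where
  "op_A \<omega> = (\<lambda>(\<xi>, \<eta>). (op_Omega \<omega> \<eta>, - op_Omega \<omega> \<xi>))"

definition op_C1 :: "('r::finite \<Rightarrow> nat \<Rightarrow> real) \<Rightarrow> ell2 \<Rightarrow> real ^ 'r" where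
  "op_C1 c \<xi> = (\<chi> s. \<Sum>j. c s j * coord \<xi> j)"

definition op_C :: "('r::finite \<Rightarrow> nat \<Rightarrow> real) \<Rightarrow> state \<Rightarrow> real ^ 'r" where
  "op_C c = (\<lambda>(\<xi>, \<eta>). op_C1 c \<xi>)"

definition comb :: "(nat \<Rightarrow> 'r::finite \<Rightarrow> real) \<Rightarrow> real ^ 'r \<Rightarrow> ell2" where
  "comb f y = Ell2 (\<lambda>j. \<Sum>s\<in>UNIV. f j s * y $ s)"

definition op_F :: "(nat \<Rightarrow> 'r::finite \<Rightarrow> real) \<Rightarrow> (nat \<Rightarrow> 'r \<Rightarrow> real) \<Rightarrow> real ^ 'r \<Rightarrow> state" where
  "op_F f g y = (comb f y, comb g y)"

definition error_op ::
    "(nat \<Rightarrow> real) \<Rightarrow> ('r::finite \<Rightarrow> nat \<Rightarrow> real) \<Rightarrow> (nat \<Rightarrow> 'r \<Rightarrow> real) \<Rightarrow> (nat \<Rightarrow> 'r \<Rightarrow> real)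
      \<Rightarrow> state \<Rightarrow> state" where
  "error_op \<omega> c f g z = op_A \<omega> z - op_F f g (op_C c z)"

text \<open>These series and sequences are well defined where they are used.\<close>

lemma coord_op_Omega:
  assumes "(\<xi>, \<eta>) \<in> dom_A \<omega>"
  shows "coord (op_Omega \<omega> \<xi>) j = \<omega> j * coord \<xi> j"
    and "coord (op_Omega \<omega> \<eta>) j = \<omega> j * coord \<eta> j"
proof -
  have *: "summable (\<lambda>j. (\<omega> j)\<^sup>2 * ((coord \<xi> j)\<^sup>2 + (coord \<eta> j)\<^sup>2))"
    using assms by (simp add: dom_A_def)
  have "summable (\<lambda>j. (\<omega> j * coord \<xi> j)\<^sup>2)"
    by (rule summable_comparison_test'[OF *, where N = 0])
      (simp add: power_mult_distrib mult_left_mono)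
  moreover have "summable (\<lambda>j. (\<omega> j * coord \<eta> j)\<^sup>2)"
    by (rule summable_comparison_test'[OF *, where N = 0])
      (simp add: power_mult_distrib mult_left_mono)
  ultimately show "coord (op_Omega \<omega> \<xi>) j = \<omega> j * coord \<xi> j"
    and "coord (op_Omega \<omega> \<eta>) j = \<omega> j * coord \<eta> j"
    by (simp_all add: op_Omega_def coord_Ell2)
qed

lemma summable_op_C1:
  assumes "summable (\<lambda>j. (c s j)\<^sup>2)"
  shows "summable (\<lambda>j. c s j * coord \<xi> j)"
  by (intro summable_mult_sq assms summable_coord_sq)

lemma coord_comb:
  fixes f :: "nat \<Rightarrow> 'r::finite \<Rightarrow> real"
  assumes "\<And>s. summable (\<lambda>j. (f j s)\<^sup>2)"
  shows "coord (comb f y) j = (\<Sum>s\<in>UNIV. f j s * y $ s)"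
proof -
  have "summable (\<lambda>j. (\<Sum>s\<in>S. f j s * y $ s)\<^sup>2)" if "finite S" for S
    using that
  proof induction
    case (insert s S)
    then show ?case
      using summable_add_sq[OF summable_scale_sq[OF assms[of s], of "y $ s"] insert.IH]
      by (simp add: mult.commute)
  qed simp
  then show ?thesis by (simp add: comb_def coord_Ell2)
qed


section \<open>Strongly continuous semigroups and asymptotic stability\<close>

definition C0_semigroup :: "(real \<Rightarrow> 'a::real_normed_vector \<Rightarrow> 'a) \<Rightarrow> bool" where
  "C0_semigroup T \<longleftrightarrow>
    (\<forall>t\<ge>0. bounded_linear (T t)) \<and>
    T 0 = id \<and>
    (\<forall>s\<ge>0. \<forall>t\<ge>0. T (s + t) = T s \<circ> T t) \<and>
    (\<forall>x. ((\<lambda>t. T t x) \<longlongrightarrow> x) (at_right 0))"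

text \<open>\<open>generates D G T\<close>: the operator \<open>G\<close> with domain exactly \<open>D\<close> is the infinitesimal
  generator of \<open>T\<close>, i.e. \<open>T t\<close> is \<open>exp (t G)\<close> for \<open>t \<ge> 0\<close>.
  The values \<open>T t\<close> with \<open>t < 0\<close> are irrelevant.\<close>

definition generates ::
    "'a::real_normed_vector set \<Rightarrow> ('a \<Rightarrow> 'a) \<Rightarrow> (real \<Rightarrow> 'a \<Rightarrow> 'a) \<Rightarrow> bool" where
  "generates D G T \<longleftrightarrow> C0_semigroup T \<and>
    (\<forall>x y. ((\<lambda>h. (T h x - x) /\<^sub>R h) \<longlongrightarrow> y) (at_right 0) \<longleftrightarrow> x \<in> D \<and> y = G x)"

definition lyapunov_stable :: "(real \<Rightarrow> 'a::real_normed_vector \<Rightarrow> 'a) \<Rightarrow> bool" where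
  "lyapunov_stable T \<longleftrightarrow>
    (\<forall>\<epsilon>>0. \<exists>\<delta>>0. \<forall>x. norm x < \<delta> \<longrightarrow> (\<forall>t\<ge>0. norm (T t x) < \<epsilon>))"

definition asymptotically_stable :: "(real \<Rightarrow> 'a::real_normed_vector \<Rightarrow> 'a) \<Rightarrow> bool" where
  "asymptotically_stable T \<longleftrightarrow>
    lyapunov_stable T \<and> (\<forall>x. ((\<lambda>t. norm (T t x)) \<longlongrightarrow> 0) at_top)"

end

theory Submission
  imports Defs "HOL-Complex_Analysis.Complex_Analysis" "HOL-Real_Asymp.Real_Asymp"
begin

text \<open>The feedback term is a bounded perturbation of the rotation group generated by \<open>A\<close>, so
  \<open>A - F C\<close> generates a semigroup with the same domain. Because \<open>A\<close> is skew-adjoint and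
  \<open>\<langle>F C z, z\<rangle> = \<Sum>s. \<gamma> s * (C z $ s)\<^sup>2\<close>, the energy decreases, and along trajectories starting in the
  domain every output tends to 0. If \<open>c s j \<noteq> 0\<close>, averaging the output \<open>s\<close> against oscillations of
  frequency \<open>\<omega> j\<close> over long time windows isolates the \<open>j\<close>-th mode, since the frequencies are
  distinct; so every mode tends to 0. The frequencies are zeros of a nonzero analytic function,
  hence tend to infinity, and the bounded graph norm makes the tails of trajectories uniformly
  small. This gives convergence on the domain, and by contractivity and density everywhere.\<close>

text \<open>Dissipation acts only through finitely many outputs, so the energy inequality alone
  gives no convergence. What supplies compactness is the commutation
  \<open>G (T t x) = T t (G x)\<close> on the domain: its right side stays below
  \<open>norm (G x)\<close>, and this one bound serves twice, as a Lipschitz bound for the outputs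
  and as a uniform bound for the tails of the orbit. Recovering one mode from a decaying output
  meets two disturbances. The output is an infinite series; it is cut at a finite N with an error
  uniform in time by contractivity, so only finitely many frequency differences occur as divisors.
  The modes are also coupled by the feedback, but this coupling is a combination of the outputs and
  therefore already known to decay. The conclusion concerns every \<open>T\<close> with the given
  generator, so stability is derived from \<open>generates\<close> alone and not from the
  construction used for existence; hence the general facts on boundedness, continuity and
  differentiability of orbits.\<close>

section \<open>The eigenfrequencies tend to infinity\<close>

text \<open>In the bracket multiplying M the cubic terms cancel, and its x^5 coefficient is l (l^2 -
  a^2)^2 / 12. The extra factor x^4 therefore removes the mass term in the limit, while the spring
  term is -K times the same bracket. With K > 0 the two surviving contributions have the same sign
  and cannot cancel.\<close>

lemma char_fun_scaled_tendsto:
  fixes M K l a :: real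
  assumes "l > 0" "-l < a" "a < l"
  shows "((\<lambda>x. (M * x ^ 4 *
        ((cosh (x * a) - cosh (x * l)) * sin (x * l) + (cos (x * a) - cos (x * l)) * sinh (x * l))
      - x ^ 3 * (sin (x * l) * sinh (x * l))
      + K * ((cosh (x * l) - cosh (x * a)) * sin (x * l) - (cos (x * a) - cos (x * l)) * sinh (x * l)))
      / x ^ 5) \<longlongrightarrow> - (l\<^sup>2 + K * (l\<^sup>2 - a\<^sup>2)\<^sup>2 * l / 12)) (at_right 0)"
  using assms unfolding cosh_def sinh_def
  by simp (real_asymp, simp add: field_simps power2_eq_square)

text \<open>Multiplying by \<open>\<mu> ^ 5\<close> makes the characteristic function entire in the wave number \<open>\<mu>\<close>;
  it does not vanish identically because its Taylor expansion at 0 starts with a nonzero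
  multiple of \<open>\<mu> ^ 5\<close>.\<close>

lemma char_fun_no_zero_sequence:
  fixes \<rho> E I m \<kappa> l l\<^sub>0 :: real
  assumes pos: "\<rho> > 0" "E > 0" "I > 0" "m > 0" "\<kappa> > 0" "l > 0" "0 < l\<^sub>0" "l\<^sub>0 < l"
    and w: "\<And>j. w j > 0" "\<And>j. char_fun \<rho> E I m \<kappa> l l\<^sub>0 (w j) = 0"
    and lim: "w \<longlonglongrightarrow> v" and v: "v > 0" and ne: "\<And>j::nat. w j \<noteq> v"
  shows False
proof -
  define a where "a = l - 2 * l\<^sub>0"
  define M where "M = m / (4 * \<rho>)"
  define K where "K = \<kappa> / (4 * E * I)"
  have a: "-l < a" "a < l" using pos by (auto simp: a_def)
  have K: "K > 0" using pos by (simp add: K_def)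
  define \<mu> where "\<mu> = wave_number \<rho> E I"
  have \<mu>pos: "\<mu> x > 0" if "x > 0" for x
    unfolding \<mu>_def wave_number_def using pos that by simp
  have \<mu>4: "\<mu> x ^ 4 = \<rho> * x\<^sup>2 / (E * I)" for x
    unfolding \<mu>_def wave_number_def using pos by (simp add: real_root_pow_pos2)
  have \<mu>inj: "x = y" if "\<mu> x = \<mu> y" "x > 0" "y > 0" for x y
  proof -
    have "x\<^sup>2 = y\<^sup>2" using \<mu>4[of x] \<mu>4[of y] that(1) pos by simp
    then show ?thesis using that by (simp add: power2_eq_iff)
  qed
  define g where "g x = M * x ^ 4 *
        ((cosh (x * a) - cosh (x * l)) * sin (x * l) + (cos (x * a) - cos (x * l)) * sinh (x * l))
      - x ^ 3 * (sin (x * l) * sinh (x * l))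
      + K * ((cosh (x * l) - cosh (x * a)) * sin (x * l) - (cos (x * a) - cos (x * l)) * sinh (x * l))"
    for x :: real
  have scale: "x ^ 5 * (m / (4 * x * \<rho>) * A - B / x\<^sup>2 + \<kappa> / (4 * E * I * x ^ 5) * C)
      = M * x ^ 4 * A - x ^ 3 * B + K * C" if "x > 0" for x A B C
  proof -
    have *: "x ^ 5 = x ^ 4 * x"
      by (simp add: eval_nat_numeral)
    have "x ^ 5 * (m / (4 * x * \<rho>)) = M * x ^ 4"
      unfolding * M_def using that pos by (simp add: field_simps)
    moreover have "x ^ 5 * (B / x\<^sup>2) = x ^ 3 * B"
      using that by (simp add: field_simps eval_nat_numeral)
    moreover have "x ^ 5 * (\<kappa> / (4 * E * I * x ^ 5)) = K"
      unfolding K_def using that by simp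
    ultimately show ?thesis
      unfolding right_diff_distrib distrib_left mult.assoc[symmetric] by simp
  qed
  have g: "g (\<mu> x) = \<mu> x ^ 5 * char_fun \<rho> E I m \<kappa> l l\<^sub>0 x" if "x > 0" for x
    unfolding g_def char_fun_def Let_def \<mu>_def[symmetric] a_def[symmetric]
    by (rule scale[OF \<mu>pos[OF that], symmetric])
  define G where "G z = of_real M * z ^ 4 *
        ((cosh (z * of_real a) - cosh (z * of_real l)) * sin (z * of_real l)
          + (cos (z * of_real a) - cos (z * of_real l)) * sinh (z * of_real l))
      - z ^ 3 * (sin (z * of_real l) * sinh (z * of_real l))
      + of_real K * ((cosh (z * of_real l) - cosh (z * of_real a)) * sin (z * of_real l)
          - (cos (z * of_real a) - cos (z * of_real l)) * sinh (z * of_real l))"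
    for z :: complex
  have G: "G (of_real x) = of_real (g x)" for x
    unfolding G_def g_def cosh_field_def sinh_field_def
    by (simp add: sin_of_real[symmetric] cos_of_real[symmetric] exp_of_real[symmetric]
        del: sin_of_real cos_of_real)
  have hol: "G holomorphic_on UNIV"
    unfolding G_def cosh_field_def sinh_field_def by (intro holomorphic_intros) auto
  define U where "U = range (\<lambda>j. complex_of_real (\<mu> (w j)))"
  have "isCont \<mu> v"
    unfolding \<mu>_def wave_number_def using pos by (intro continuous_intros) auto
  then have "(\<lambda>j. complex_of_real (\<mu> (w j))) \<longlonglongrightarrow> of_real (\<mu> v)"
    by (intro tendsto_of_real isCont_tendsto_compose[OF _ lim])
  \<comment> \<open>\<open>\<mu>\<close> is injective on positive arguments, so the points
    \<open>\<mu> (w j)\<close> differ from their limit \<open>\<mu> v\<close>, which is thus a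
    genuine accumulation point of zeros of \<open>G\<close>.\<close>
  then have isl: "of_real (\<mu> v) islimpt U"
    unfolding islimpt_sequential U_def using \<mu>inj w(1) v ne
    by (intro exI[of _ "\<lambda>j. complex_of_real (\<mu> (w j))"]) auto
  have "G z = 0" for z
  proof (rule analytic_continuation[OF hol _ _ _ _ isl])
    show "G u = 0" if "u \<in> U" for u
      using that g[OF w(1)] w(2) by (auto simp: U_def G)
  qed auto
  then have "g x = 0" for x
    using G[of x] by (metis of_real_eq_0_iff)
  then have "((\<lambda>x::real. 0 / x ^ 5) \<longlongrightarrow> - (l\<^sup>2 + K * (l\<^sup>2 - a\<^sup>2)\<^sup>2 * l / 12)) (at_right 0)"
    using char_fun_scaled_tendsto[OF _ a, of M K] pos unfolding g_def by simp
  then have "- (l\<^sup>2 + K * (l\<^sup>2 - a\<^sup>2)\<^sup>2 * l / 12) = 0"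
    by (intro tendsto_unique[OF _ _ tendsto_const]) auto
  moreover have "l\<^sup>2 + K * (l\<^sup>2 - a\<^sup>2)\<^sup>2 * l / 12 > 0"
    using K pos by (intro add_pos_nonneg) auto
  ultimately show False by simp
qed

text \<open>A bounded strictly increasing sequence would converge to a positive limit that it never
  attains, which is the situation just excluded.\<close>

lemma char_fun_zeros_at_top:
  fixes \<rho> E I m \<kappa> l l\<^sub>0 :: real
  assumes pos: "\<rho> > 0" "E > 0" "I > 0" "m > 0" "\<kappa> > 0" "l > 0" "0 < l\<^sub>0" "l\<^sub>0 < l"
    and mono: "strict_mono \<omega>"
    and zeros: "range \<omega> \<subseteq> {w. w > 0 \<and> char_fun \<rho> E I m \<kappa> l l\<^sub>0 w = 0}"
  shows "filterlim \<omega> at_top sequentially"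
proof (rule ccontr)
  assume not_top: "\<not> ?thesis"
  have "incseq \<omega>" using mono by (simp add: strict_mono_mono)
  obtain B where B: "\<And>j. \<omega> j \<le> B"
  proof -
    have "\<exists>B. \<forall>j. \<omega> j \<le> B"
    proof (rule ccontr)
      assume "\<nexists>B. \<forall>j. \<omega> j \<le> B"
      then have "\<exists>N. \<omega> N \<ge> Z" for Z by (meson linear)
      then have "\<exists>N. \<forall>n\<ge>N. \<omega> n \<ge> Z" for Z
        using \<open>incseq \<omega>\<close> by (meson incseqD order_trans)
      then show False using not_top by (simp add: filterlim_at_top eventually_sequentially)
    qed
    then show ?thesis using that by blast
  qed
  obtain v where v: "\<omega> \<longlonglongrightarrow> v" "\<And>j. \<omega> j \<le> v"
    using incseq_convergent[OF \<open>incseq \<omega>\<close>] B by metis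
  have lt: "\<omega> j < v" for j
    using v(2)[of "Suc j"] strict_monoD[OF mono, of j "Suc j"] by simp
  have w: "\<omega> j > 0" "char_fun \<rho> E I m \<kappa> l l\<^sub>0 (\<omega> j) = 0" for j
    using zeros by auto
  have "v > 0" using w(1)[of 0] lt[of 0] by simp
  then show False
    using char_fun_no_zero_sequence[OF pos w v(1)] lt by (metis less_irrefl)
qed

section \<open>Bounded perturbations of isometry groups\<close>

locale isometry_group =
  fixes S :: "real \<Rightarrow> 'a::banach \<Rightarrow> 'a"
  assumes linear_S: "linear (S t)"
    and S_add: "S (s + t) x = S s (S t x)"
    and norm_S [simp]: "norm (S t x) = norm x"
    and S_at_right: "((\<lambda>t. S t x) \<longlongrightarrow> x) (at_right 0)"
begin

lemma bounded_linear_S: "bounded_linear (S t)"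
  by (rule bounded_linear_intro[of _ 1])
    (simp_all add: linear_add[OF linear_S] linear_cmul[OF linear_S])

text \<open>\<open>S 0\<close> is idempotent and isometric: it sends \<open>S 0 x - x\<close> to 0,
  so this vector has norm 0.\<close>

lemma S_0 [simp]: "S 0 x = x"
proof -
  have "S 0 (S 0 x - x) = 0"
    using S_add[of 0 0 x] by (simp add: linear_diff[OF linear_S])
  then have "norm (S 0 x - x) = 0" using norm_S[of 0 "S 0 x - x"] by simp
  then show ?thesis by simp
qed

text \<open>Right continuity at 0 spreads to all times and both sides, because
  \<open>S (s + h) x - S s x\<close> is the isometric image of \<open>S h x - x\<close> under
  \<open>S s\<close>; the modulus of continuity does not depend on s.\<close>

lemma continuous_S: "continuous_on UNIV (\<lambda>t. S t x)"
proof (rule iffD2[OF continuous_on_iff], intro ballI allI impI)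
  fix t e :: real assume e: "e > 0"
  have "\<forall>\<^sub>F h in at_right 0. dist (S h x) x < e"
    using S_at_right e by (simp add: tendsto_iff)
  then obtain d where d: "d > 0" "\<And>h. 0 < h \<Longrightarrow> h < d \<Longrightarrow> norm (S h x - x) < e"
    unfolding eventually_at_right_field dist_norm by auto
  have close: "norm (S (s + h) x - S s x) < e" if "0 \<le> h" "h < d" for s h
  proof (cases "h = 0")
    case False
    have "S (s + h) x - S s x = S s (S h x - x)"
      by (simp add: S_add linear_diff[OF linear_S])
    then show ?thesis using d(2)[of h] that False by simp
  qed (use e in simp)
  show "\<exists>d>0. \<forall>t'\<in>UNIV. dist t' t < d \<longrightarrow> dist (S t' x) (S t x) < e"
  proof (intro exI[of _ d] conjI ballI impI)
    fix s assume s: "dist s t < d"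
    then show "dist (S s x) (S t x) < e"
      using close[of "t - s" s] close[of "s - t" t]
      by (cases "s \<le> t") (auto simp: dist_norm norm_minus_commute)
  qed (use d in auto)
qed

text \<open>Joint continuity: moving the vector from w to \<open>v t\<close> costs exactly
  \<open>norm (v t - w)\<close>, whatever the time argument is.\<close>

lemma tendsto_S:
  assumes "(f \<longlongrightarrow> a) F" "(v \<longlongrightarrow> w) F"
  shows "((\<lambda>t. S (f t) (v t)) \<longlongrightarrow> S a w) F"
proof -
  have "((\<lambda>t. S (f t) w) \<longlongrightarrow> S a w) F"
    using continuous_S[of w] assms(1)
    by (intro isCont_tendsto_compose[of _ "\<lambda>t. S t w"]) (auto simp: continuous_on_eq_continuous_at)
  moreover have "((\<lambda>t. S (f t) (v t - w)) \<longlongrightarrow> 0) F"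
    by (rule tendsto_norm_zero_cancel) (simp add: LIM_zero assms(2) tendsto_norm_zero)
  ultimately have "((\<lambda>t. S (f t) w + S (f t) (v t - w)) \<longlongrightarrow> S a w + 0) F"
    by (rule tendsto_add)
  then show ?thesis by (simp add: linear_diff[OF linear_S])
qed

lemma continuous_on_S:
  "continuous_on X f \<Longrightarrow> continuous_on X v \<Longrightarrow> continuous_on X (\<lambda>t. S (f t) (v t))"
  unfolding continuous_on_def by (blast intro: tendsto_S)

end

section \<open>Variation of constants: Duhamel integrals and mild solutions\<close>

locale perturbed_isometry_group = isometry_group S for S :: "real \<Rightarrow> 'a::banach \<Rightarrow> 'a" +
  fixes P :: "'a \<Rightarrow> 'a" and K :: real
  assumes linear_P: "linear P" and K_pos: "K > 0" and norm_P: "norm (P x) \<le> K * norm x"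
begin

lemma bounded_linear_P: "bounded_linear P"
  by (rule bounded_linear_intro[of _ K])
    (simp_all add: linear_add[OF linear_P] linear_cmul[OF linear_P] norm_P mult.commute)

text \<open>The group inverse allows \<open>S t\<close> to be pulled out of the
  variation-of-constants formula. The remaining integrand does not depend on t, so this is an
  ordinary indefinite integral.\<close>

definition duhamel :: "(real \<Rightarrow> 'a) \<Rightarrow> real \<Rightarrow> 'a" where
  "duhamel u t = integral {0..t} (\<lambda>s. S (- s) (P (u s)))"

lemma continuous_integrand:
  "continuous_on X u \<Longrightarrow> continuous_on X (\<lambda>s. S (- s) (P (u s)))"
  by (intro continuous_on_S bounded_linear.continuous_on[OF bounded_linear_P] continuous_intros)

text \<open>Origin of the exponent \<open>2 * K\<close>: integrating
  \<open>K * B * exp (2 * K * s)\<close> returns half of the assumed bound. This factor 1/2 drives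
  both existence and uniqueness.\<close>

lemma duhamel_bound:
  assumes u: "continuous_on {0..t} u" and t: "t \<ge> 0"
    and B: "\<And>s. 0 \<le> s \<Longrightarrow> s \<le> t \<Longrightarrow> norm (u s) \<le> B * exp (2 * K * s)"
  shows "norm (duhamel u t) \<le> B / 2 * exp (2 * K * t)"
proof -
  have "0 \<le> norm (u 0)" "norm (u 0) \<le> B" using B[of 0] t by auto
  then have B0: "B \<ge> 0" by linarith
  have "((\<lambda>s. K * (B * exp (2 * K * s))) has_integral
      (B / 2 * exp (2 * K * t) - B / 2 * exp (2 * K * 0))) {0..t}"
    using K_pos t
    by (intro fundamental_theorem_of_calculus)
      (auto intro!: derivative_eq_intros simp flip: has_real_derivative_iff_has_vector_derivative)
  note int = this
  have "norm (duhamel u t) \<le> integral {0..t} (\<lambda>s. K * (B * exp (2 * K * s)))"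
    unfolding duhamel_def
  proof (rule integral_norm_bound_integral)
    show "(\<lambda>s. S (- s) (P (u s))) integrable_on {0..t}"
      by (intro integrable_continuous_real continuous_integrand u)
    show "norm (S (- s) (P (u s))) \<le> K * (B * exp (2 * K * s))" if "s \<in> {0..t}" for s
      using order_trans[OF norm_P mult_left_mono[OF B[of s]]] that K_pos by simp
  qed (use int in \<open>auto simp: integrable_on_def\<close>)
  also have "\<dots> = B / 2 * exp (2 * K * t) - B / 2"
    using integral_unique[OF int] by simp
  finally show ?thesis using B0 by simp
qed

lemma continuous_duhamel:
  assumes "continuous_on {0..} u"
  shows "continuous_on {0..} (duhamel u)"
proof (rule continuous_on_subset[of "{0..}"])
  have "continuous_on {0..b} (duhamel u)" for b
    unfolding duhamel_def
    by (intro indefinite_integral_continuous_1 integrable_continuous_real continuous_integrand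
        continuous_on_subset[OF assms]) auto
  then show "continuous_on {0..} (duhamel u)"
    unfolding continuous_on_eq_continuous_within
  proof (intro ballI)
    fix t :: real assume t: "t \<in> {0..}"
    assume *: "\<And>b. \<forall>x\<in>{0..b}. continuous (at x within {0..b}) (duhamel u)"
    \<comment> \<open>Continuity is known on compact intervals only; near t the interval up to t + 1
      looks like the whole half-line.\<close>
    have "at t within {0..t + 1} = at t within {0..}"
      by (rule at_within_nhd[of _ "{t - 1<..<t + 1}"]) auto
    then show "continuous (at t within {0..}) (duhamel u)"
      using *[of "t + 1"] t by force
  qed
qed auto

lemma duhamel_diff:
  assumes "continuous_on {0..} u" "continuous_on {0..} v" "\<And>s. s \<ge> 0 \<Longrightarrow> w s = u s - v s"
  shows "duhamel w t = duhamel u t - duhamel v t"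
proof -
  have "duhamel w t = integral {0..t} (\<lambda>s. S (- s) (P (u s)) - S (- s) (P (v s)))"
    unfolding duhamel_def
    by (intro integral_cong) (simp add: assms(3) linear_diff[OF linear_P] linear_diff[OF linear_S])
  also have "\<dots> = duhamel u t - duhamel v t"
    unfolding duhamel_def
    by (intro Henstock_Kurzweil_Integration.integral_diff integrable_continuous_real
        continuous_integrand continuous_on_subset[OF assms(1)] continuous_on_subset[OF assms(2)]) auto
  finally show ?thesis .
qed

lemma duhamel_scale:
  assumes "\<And>s. s \<ge> 0 \<Longrightarrow> w s = c *\<^sub>R u s"
  shows "duhamel w t = c *\<^sub>R duhamel u t"
proof -
  have "duhamel w t = integral {0..t} (\<lambda>s. c *\<^sub>R S (- s) (P (u s)))"
    unfolding duhamel_def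
    by (intro integral_cong) (simp add: assms linear_cmul[OF linear_P] linear_cmul[OF linear_S])
  then show ?thesis by (simp add: duhamel_def)
qed

text \<open>The growth bound is part of the notion of solution, so that the contraction estimate in
  the norm weighted by \<open>exp (- 2 * K * t)\<close> gives uniqueness as well.\<close>

definition mild_solution :: "'a \<Rightarrow> (real \<Rightarrow> 'a) \<Rightarrow> bool" where
  "mild_solution x u \<longleftrightarrow> continuous_on {0..} u \<and>
    (\<exists>B. \<forall>t\<ge>0. norm (u t) \<le> B * exp (2 * K * t)) \<and>
    (\<forall>t\<ge>0. u t = S t (x + duhamel u t))"

lemma mild_solutionD:
  assumes "mild_solution x u"
  shows "continuous_on {0..} u" "\<exists>B. \<forall>t\<ge>0. norm (u t) \<le> B * exp (2 * K * t)"
    "t \<ge> 0 \<Longrightarrow> u t = S t (x + duhamel u t)"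
  using assms unfolding mild_solution_def by blast+

text \<open>Banach's fixed point theorem for the function w in
  \<open>u t = exp (2 * K * t) *\<^sub>R w t\<close>. The supremum norm of w is the weighted norm of
  u, in which the Duhamel term contracts by 1/2 on the whole half-line at once.\<close>

lemma mild_solution_exists: "\<exists>u. mild_solution x u"
proof -
  \<comment> \<open>Elements of \<open>bcontfun\<close> live on the whole real line, so the equation
    is imposed at time \<open>max 0 t\<close>, which extends the iterates by a constant to negative
    times.\<close>
  define pos :: "real \<Rightarrow> real" where "pos t = max 0 t" for t
  have pos: "pos t \<ge> 0" "t \<ge> 0 \<Longrightarrow> pos t = t" for t by (auto simp: pos_def)
  have cont_pos: "continuous_on X pos" for X unfolding pos_def by (intro continuous_intros)
  define lift where "lift w s = exp (2 * K * s) *\<^sub>R apply_bcontfun w s" for w :: "real \<Rightarrow>\<^sub>C 'a" and s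
  have cont_lift: "continuous_on X (lift w)" for X w
    unfolding lift_def by (intro continuous_intros continuous_on_apply_bcontfun)
  have lift_bound: "norm (lift v s - lift w s) \<le> dist v w * exp (2 * K * s)" for v w s
  proof -
    have "norm (lift v s - lift w s) = exp (2 * K * s) * dist (apply_bcontfun v s) (apply_bcontfun w s)"
      by (simp add: lift_def dist_norm flip: scaleR_right_diff_distrib)
    then show ?thesis using dist_bounded[of v s w] by (simp add: mult.commute)
  qed
  define f where "f w t = exp (- (2 * K * pos t)) *\<^sub>R S (pos t) (x + duhamel (lift w) (pos t))" for w t
  have cont_d: "continuous_on UNIV (\<lambda>t. duhamel (lift w) (pos t))" for w
    using continuous_on_compose2[OF continuous_duhamel[OF cont_lift[of _ w]] cont_pos[of UNIV]] pos
    by auto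
  have lift0: "lift 0 s = 0" for s by (simp add: lift_def)
  have f_diff: "norm (f v t - f w t) \<le> 1 / 2 * dist v w" for v w t
  proof -
    have "duhamel (lift v) (pos t) - duhamel (lift w) (pos t)
        = duhamel (\<lambda>s. lift v s - lift w s) (pos t)"
      by (rule duhamel_diff[symmetric]) (auto intro: cont_lift)
    moreover have "norm (duhamel (\<lambda>s. lift v s - lift w s) (pos t)) \<le> dist v w / 2 * exp (2 * K * pos t)"
      by (intro duhamel_bound continuous_intros cont_lift lift_bound pos)
    ultimately have "norm (S (pos t) (duhamel (lift v) (pos t) - duhamel (lift w) (pos t)))
        \<le> dist v w / 2 * exp (2 * K * pos t)" by simp
    moreover have "f v t - f w t
        = exp (- (2 * K * pos t)) *\<^sub>R S (pos t) (duhamel (lift v) (pos t) - duhamel (lift w) (pos t))"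
      by (simp add: f_def linear_diff[OF linear_S] linear_add[OF linear_S]
          flip: scaleR_right_diff_distrib)
    ultimately show ?thesis by (simp add: exp_minus field_simps)
  qed
  have f_bcontfun: "f w \<in> bcontfun" for w
  proof (rule bcontfun_normI)
    show "continuous_on UNIV (f w)"
      unfolding f_def by (intro continuous_intros continuous_on_S cont_pos cont_d)
    have "norm (f w t) \<le> norm x + 1 / 2 * dist w 0" for t
    proof -
      have "duhamel (lift 0) (pos t) = 0"
        by (simp add: duhamel_def lift0 linear_0[OF linear_P] linear_0[OF linear_S])
      then have "norm (f 0 t) \<le> norm x"
        using K_pos pos[of t] by (simp add: f_def mult_left_le_one_le)
      then show ?thesis using f_diff[of w t 0] norm_triangle_sub[of "f w t" "f 0 t"] by linarith
    qed
    then show "\<And>t. norm (f w t) \<le> norm x + 1 / 2 * dist w 0" .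
  qed
  have "\<exists>!w. Bcontfun (f w) = w"
  proof (rule banach_fix_type[of "1 / 2"])
    show "\<forall>v w. dist (Bcontfun (f v)) (Bcontfun (f w)) \<le> 1 / 2 * dist v w"
      using f_diff by (intro allI dist_bound) (simp add: Bcontfun_inverse[OF f_bcontfun] dist_norm)
  qed auto
  then obtain w where "Bcontfun (f w) = w" by blast
  then have fix_w: "apply_bcontfun w t = f w t" for t
    by (metis Bcontfun_inverse[OF f_bcontfun])
  have "mild_solution x (lift w)"
    unfolding mild_solution_def
  proof (intro conjI allI impI cont_lift exI)
    fix t :: real assume t: "t \<ge> 0"
    show "norm (lift w t) \<le> dist w 0 * exp (2 * K * t)"
      using lift_bound[of w t 0] by (simp add: lift0)
    show "lift w t = S t (x + duhamel (lift w) t)"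
      unfolding lift_def[of w t] fix_w by (simp add: f_def pos t exp_minus)
  qed
  then show ?thesis by blast
qed

text \<open>Inserting a bound with coefficient b into the integral equation yields the coefficient
  \<open>norm x + b / 2\<close>, a map with fixed point \<open>2 * norm x\<close>. Iteration
  eliminates the unknown growth constant B; for x = 0 the result is uniqueness.\<close>

lemma mild_solution_bound:
  assumes u: "mild_solution x u" and t: "t \<ge> 0"
  shows "norm (u t) \<le> 2 * norm x * exp (2 * K * t)"
proof -
  obtain B where B: "\<And>t. t \<ge> 0 \<Longrightarrow> norm (u t) \<le> B * exp (2 * K * t)"
    using mild_solutionD(2)[OF u] by blast
  have *: "norm (u t) \<le> (2 * norm x + \<bar>B\<bar> * (1 / 2) ^ n) * exp (2 * K * t)" if "t \<ge> 0" for n t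
    using that
  proof (induction n arbitrary: t)
    case 0
    have "B * exp (2 * K * t) \<le> (2 * norm x + \<bar>B\<bar>) * exp (2 * K * t)"
      by (intro mult_right_mono) (use norm_ge_zero[of x] in \<open>linarith, simp\<close>)
    then show ?case using order_trans[OF B[OF 0]] by simp
  next
    case (Suc n)
    have "norm (u t) = norm (x + duhamel u t)"
      using u Suc.prems by (simp add: mild_solution_def)
    also have "\<dots> \<le> norm x + norm (duhamel u t)" by (rule norm_triangle_ineq)
    finally have "norm (u t) \<le> norm x + norm (duhamel u t)" .
    moreover have "norm (duhamel u t) \<le> (2 * norm x + \<bar>B\<bar> * (1 / 2) ^ n) / 2 * exp (2 * K * t)"
      using u Suc by (intro duhamel_bound) (auto simp: mild_solution_def intro: continuous_on_subset)
    moreover have "norm x \<le> norm x * exp (2 * K * t)"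
      using K_pos Suc.prems by (simp add: mult_le_cancel_left1)
    moreover have "(2 * norm x + \<bar>B\<bar> * (1 / 2) ^ Suc n) * exp (2 * K * t)
        = norm x * exp (2 * K * t) + (2 * norm x + \<bar>B\<bar> * (1 / 2) ^ n) / 2 * exp (2 * K * t)"
    proof -
      have "(2 * a + q / 2) * e = a * e + (2 * a + q) / 2 * e" for a q e :: real
        by (simp add: algebra_simps add_divide_distrib)
      from this[of "norm x" "\<bar>B\<bar> * (1 / 2) ^ n" "exp (2 * K * t)"] show ?thesis
        by (simp add: mult.commute)
    qed
    ultimately show ?case by linarith
  qed
  have "(\<lambda>n. (2 * norm x + \<bar>B\<bar> * (1 / 2) ^ n) * exp (2 * K * t))
      \<longlonglongrightarrow> (2 * norm x + \<bar>B\<bar> * 0) * exp (2 * K * t)"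
    by (intro tendsto_intros LIMSEQ_power_zero) auto
  then have "norm (u t) \<le> (2 * norm x + \<bar>B\<bar> * 0) * exp (2 * K * t)"
    by (rule LIMSEQ_le_const) (use *[OF t] in blast)
  then show ?thesis by simp
qed

lemma mild_solution_diff:
  assumes "mild_solution x u" "mild_solution y v"
  shows "mild_solution (x - y) (\<lambda>t. u t - v t)"
proof -
  obtain B C where BC: "\<And>t. t \<ge> 0 \<Longrightarrow> norm (u t) \<le> B * exp (2 * K * t)"
    "\<And>t. t \<ge> 0 \<Longrightarrow> norm (v t) \<le> C * exp (2 * K * t)"
    using mild_solutionD(2)[OF assms(1)] mild_solutionD(2)[OF assms(2)] by blast
  have "norm (u t - v t) \<le> (B + C) * exp (2 * K * t)" if "t \<ge> 0" for t
    using norm_triangle_ineq4[of "u t" "v t"] BC[OF that] by (simp add: distrib_right)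
  moreover have cont: "continuous_on {0..} u" "continuous_on {0..} v"
    using assms by (auto simp: mild_solution_def)
  moreover have "u t - v t = S t (x - y + duhamel (\<lambda>t. u t - v t) t)" if "t \<ge> 0" for t
  proof -
    have "S t (x - y + duhamel (\<lambda>t. u t - v t) t)
        = S t ((x + duhamel u t) - (y + duhamel v t))"
      by (simp add: duhamel_diff[OF cont] add_diff_add)
    also have "\<dots> = u t - v t"
      using assms that by (simp add: mild_solution_def linear_diff[OF linear_S])
    finally show ?thesis by simp
  qed
  ultimately show ?thesis
    unfolding mild_solution_def by (auto intro: continuous_on_diff)
qed

lemma mild_solution_scale:
  assumes "mild_solution x u"
  shows "mild_solution (c *\<^sub>R x) (\<lambda>t. c *\<^sub>R u t)"
proof -
  obtain B where B: "\<And>t. t \<ge> 0 \<Longrightarrow> norm (u t) \<le> B * exp (2 * K * t)"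
    using mild_solutionD(2)[OF assms] by blast
  have "norm (c *\<^sub>R u t) \<le> (\<bar>c\<bar> * B) * exp (2 * K * t)" if "t \<ge> 0" for t
    using mult_left_mono[OF B[OF that], of "\<bar>c\<bar>"] by (simp add: mult.assoc)
  moreover have "c *\<^sub>R u t = S t (c *\<^sub>R x + duhamel (\<lambda>t. c *\<^sub>R u t) t)" if "t \<ge> 0" for t
  proof -
    have "S t (c *\<^sub>R x + duhamel (\<lambda>t. c *\<^sub>R u t) t) = c *\<^sub>R S t (x + duhamel u t)"
      by (simp add: duhamel_scale[of _ c u] linear_cmul[OF linear_S] flip: scaleR_add_right)
    then show ?thesis using assms that by (simp add: mild_solution_def)
  qed
  moreover have "continuous_on {0..} (\<lambda>t. c *\<^sub>R u t)"
    by (intro continuous_intros mild_solutionD(1)[OF assms])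
  ultimately show ?thesis unfolding mild_solution_def by blast
qed

lemma mild_solution_unique:
  assumes "mild_solution x u" "mild_solution x v" "t \<ge> 0"
  shows "u t = v t"
  using mild_solution_bound[OF mild_solution_diff[OF assms(1,2)] assms(3)] by simp

text \<open>With uniqueness this becomes the semigroup law. Splitting the integral at a and moving
  \<open>S a\<close> inside turns \<open>S (- s)\<close> into \<open>S (a - s)\<close>, and the
  substitution s = a + s' yields the Duhamel integral of the shifted function.\<close>

lemma mild_solution_shift:
  assumes u: "mild_solution x u" and a: "a \<ge> 0"
  shows "mild_solution (u a) (\<lambda>t. u (a + t))"
proof -
  define f where "f s = S (- s) (P (u s))" for s
  obtain B where B: "\<And>t. t \<ge> 0 \<Longrightarrow> norm (u t) \<le> B * exp (2 * K * t)"
    using mild_solutionD(2)[OF u] by blast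
  have cont: "continuous_on {0..} u"
    and eq: "\<And>t. t \<ge> 0 \<Longrightarrow> u t = S t (x + duhamel u t)"
    using u by (auto simp: mild_solution_def)
  have "norm (u (a + t)) \<le> (B * exp (2 * K * a)) * exp (2 * K * t)" if "t \<ge> 0" for t
    using B[of "a + t"] a that by (simp add: distrib_left exp_add mult.assoc)
  moreover have "u (a + t) = S t (u a + duhamel (\<lambda>t. u (a + t)) t)" if t: "t \<ge> 0" for t
  proof -
    have "S a (integral {a..a + t} f) = integral {a..a + t} (\<lambda>s. S a (f s))"
      using integral_linear[OF _ bounded_linear_S[of a], of f "{a..a + t}"]
        integrable_continuous_real[of a "a + t" f]
        continuous_integrand[OF continuous_on_subset[OF cont], of "{a..a + t}"] a
      by (simp add: comp_def f_def subset_iff)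
    also have "\<dots> = integral {0 + a..t + a} (\<lambda>s. S a (f s))"
      by (simp add: add.commute)
    also have "\<dots> = integral {0..t} ((\<lambda>s. S a (f s)) \<circ> (+) a)"
      by (rule integral_shift_Icc_real[symmetric])
    also have "\<dots> = duhamel (\<lambda>t. u (a + t)) t"
      unfolding duhamel_def f_def by (simp add: comp_def flip: S_add)
    finally have shift: "S a (integral {a..a + t} f) = duhamel (\<lambda>t. u (a + t)) t" .
    have f: "f integrable_on {0..a + t}"
      unfolding f_def
      by (intro integrable_continuous_real continuous_integrand continuous_on_subset[OF cont]) auto
    have "duhamel u b = integral {0..b} f" for b
      unfolding duhamel_def f_def ..
    then have "duhamel u (a + t) = duhamel u a + integral {a..a + t} f"
      using Henstock_Kurzweil_Integration.integral_combine[OF _ _ f, of a] a t by simp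
    then have "u (a + t) = S t (S a ((x + duhamel u a) + integral {a..a + t} f))"
      using eq[of "a + t"] a t S_add[of t a] by (simp add: add.commute add.assoc add.left_commute)
    also have "\<dots> = S t (u a + duhamel (\<lambda>t. u (a + t)) t)"
      by (simp only: linear_add[OF linear_S, of a] shift eq[OF a])
    finally show ?thesis .
  qed
  moreover have "continuous_on {0..} (\<lambda>t. u (a + t))"
    by (rule continuous_on_compose2[OF cont]) (use a in \<open>auto intro!: continuous_intros\<close>)
  ultimately show ?thesis unfolding mild_solution_def by blast
qed

section \<open>The semigroup of mild solutions and its generator\<close>

definition perturbed :: "real \<Rightarrow> 'a \<Rightarrow> 'a" where
  "perturbed t x = (SOME u. mild_solution x u) t"

lemma mild_solution_perturbed: "mild_solution x (\<lambda>t. perturbed t x)"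
  unfolding perturbed_def by (rule someI_ex[OF mild_solution_exists])

text \<open>The choice in \<open>perturbed\<close> is harmless for t >= 0: linearity and the
  semigroup law follow by exhibiting some mild solution with the right initial value.\<close>

lemma perturbed_eqI: "mild_solution x u \<Longrightarrow> t \<ge> 0 \<Longrightarrow> perturbed t x = u t"
  by (rule mild_solution_unique[OF mild_solution_perturbed])

lemma perturbed_0: "perturbed 0 x = x"
  using mild_solution_perturbed[of x] by (simp add: mild_solution_def duhamel_def)

lemma C0_semigroup_perturbed: "C0_semigroup perturbed"
  unfolding C0_semigroup_def
proof (intro conjI allI impI ext)
  fix t :: real assume t: "t \<ge> 0"
  note m = mild_solution_perturbed
  have scale: "perturbed t (c *\<^sub>R x) = c *\<^sub>R perturbed t x" for c x
    by (rule perturbed_eqI[OF mild_solution_scale[OF m] t])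
  have diff: "perturbed t (x - y) = perturbed t x - perturbed t y" for x y
    by (rule perturbed_eqI[OF mild_solution_diff[OF m m] t])
  have "perturbed t (x + y) = perturbed t x + perturbed t y" for x y
    using diff[of x "(- 1) *\<^sub>R y"] scale[of "- 1" y] by simp
  then show "bounded_linear (perturbed t)"
    using scale mild_solution_bound[OF m t]
    by (intro bounded_linear_intro[of _ "2 * exp (2 * K * t)"]) (auto simp: mult_ac)
next
  show "perturbed 0 x = id x" for x by (simp add: perturbed_0)
  show "perturbed (s + t) x = (perturbed s \<circ> perturbed t) x" if "s \<ge> 0" "t \<ge> 0" for s t x
    using perturbed_eqI[OF mild_solution_shift[OF mild_solution_perturbed that(2)] that(1)]
    by (simp add: add.commute)
  show "((\<lambda>t. perturbed t x) \<longlongrightarrow> x) (at_right 0)" for x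
  proof -
    have "((\<lambda>t. perturbed t x) \<longlongrightarrow> perturbed 0 x) (at 0 within {0..})"
      using mild_solutionD(1)[OF mild_solution_perturbed, of x] unfolding continuous_on_def by auto
    then show ?thesis
      unfolding perturbed_0 by (rule tendsto_within_subset) auto
  qed
qed

text \<open>The difference of the two quotients is \<open>S h\<close> applied to
  \<open>duhamel u h /\<^sub>R h\<close>, and the derivative of \<open>duhamel u\<close> at 0 is
  \<open>P x\<close>. Hence either quotient converges if and only if the other does, which is why
  the perturbation leaves the domain exactly unchanged.\<close>

lemma perturbed_difference_quotient:
  "((\<lambda>h. (perturbed h x - x) /\<^sub>R h - (S h x - x) /\<^sub>R h) \<longlongrightarrow> P x) (at_right 0)"
proof -
  define u where "u t = perturbed t x" for t
  have u: "mild_solution x u" unfolding u_def by (rule mild_solution_perturbed)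
  have "continuous_on {0..1} u" using u by (auto simp: mild_solution_def intro: continuous_on_subset)
  then have "(duhamel u has_vector_derivative S (- 0) (P (u 0))) (at 0 within {0..1})"
    unfolding duhamel_def by (intro integral_has_vector_derivative continuous_integrand) auto
  then have "((\<lambda>h. (duhamel u h - duhamel u 0 - (h - 0) *\<^sub>R P x) /\<^sub>R norm (h - 0)) \<longlongrightarrow> 0)
      (at 0 within {0..1})"
    by (simp add: has_vector_derivative_def has_derivative_at_within u_def perturbed_0)
  then have "((\<lambda>h. (duhamel u h - duhamel u 0 - (h - 0) *\<^sub>R P x) /\<^sub>R norm (h - 0)) \<longlongrightarrow> 0)
      (at_right 0)"
    unfolding at_within_Icc_at_right[OF zero_less_one] .
  moreover have "\<forall>\<^sub>F h in at_right 0. (duhamel u h - duhamel u 0 - (h - 0) *\<^sub>R P x) /\<^sub>R norm (h - 0)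
      = duhamel u h /\<^sub>R h - P x"
    unfolding eventually_at_filter
    by (auto simp: duhamel_def scaleR_right_diff_distrib)
  ultimately have "((\<lambda>h. duhamel u h /\<^sub>R h - P x) \<longlongrightarrow> 0) (at_right 0)"
    by (rule Lim_transform_eventually)
  then have "((\<lambda>h. duhamel u h /\<^sub>R h) \<longlongrightarrow> P x) (at_right 0)"
    by (rule LIM_zero_cancel)
  then have "((\<lambda>h. S h (duhamel u h /\<^sub>R h)) \<longlongrightarrow> S 0 (P x)) (at_right 0)"
    by (intro tendsto_S) auto
  moreover have "\<forall>\<^sub>F h in at_right 0. S h (duhamel u h /\<^sub>R h)
      = (perturbed h x - x) /\<^sub>R h - (S h x - x) /\<^sub>R h"
  proof -
    have "S h (duhamel u h /\<^sub>R h) = (u h - x) /\<^sub>R h - (S h x - x) /\<^sub>R h" if "h > 0" for h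
      using u that
      by (simp add: mild_solution_def linear_add[OF linear_S] linear_cmul[OF linear_S]
          flip: scaleR_right_diff_distrib)
    then show ?thesis by (auto simp: eventually_at_filter u_def)
  qed
  ultimately show ?thesis
    by (simp add: Lim_transform_eventually)
qed

theorem generates_perturbed:
  assumes "generates D A S"
  shows "generates D (\<lambda>x. A x + P x) perturbed"
  unfolding generates_def
proof (intro conjI allI C0_semigroup_perturbed)
  fix x y
  have "((\<lambda>h. (perturbed h x - x) /\<^sub>R h) \<longlongrightarrow> y) (at_right 0)
      \<longleftrightarrow> ((\<lambda>h. (S h x - x) /\<^sub>R h) \<longlongrightarrow> y - P x) (at_right 0)" (is "?l \<longleftrightarrow> ?r")
  proof
    assume ?l
    from tendsto_diff[OF this perturbed_difference_quotient[of x]] show ?r by simp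
  next
    assume ?r
    from tendsto_add[OF this perturbed_difference_quotient[of x]] show ?l by simp
  qed
  also have "\<dots> \<longleftrightarrow> x \<in> D \<and> y - P x = A x" using assms by (simp add: generates_def)
  finally show "((\<lambda>h. (perturbed h x - x) /\<^sub>R h) \<longlongrightarrow> y) (at_right 0) \<longleftrightarrow> x \<in> D \<and> y = A x + P x"
    by (auto simp: algebra_simps)
qed

end

section \<open>Orbits of strongly continuous semigroups\<close>

text \<open>Banach-Steinhaus by Baire category: some \<open>A N\<close> contains a ball around z of
  radius r. A vector v of length r is the difference of z + v and z, so every \<open>L n v\<close>
  has norm at most 2 N, and scaling gives the constant 2 N / r.\<close>

lemma uniform_boundedness_sequence:
  fixes L :: "nat \<Rightarrow> 'a::banach \<Rightarrow> 'b::real_normed_vector"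
  assumes lin: "\<And>n. bounded_linear (L n)"
    and bdd: "\<And>x. bounded (range (\<lambda>n. L n x))"
  shows "\<exists>M\<ge>0. \<forall>n x. norm (L n x) \<le> M * norm x"
proof -
  define A where "A N = {x. \<forall>n. norm (L n x) \<le> real N}" for N
  have cont: "continuous_on UNIV (L n)" for n
    using lin linear_continuous_on by blast
  have closed: "closed (A N)" for N
    unfolding A_def by (intro closed_Collect_all closed_Collect_le continuous_intros cont)
  have cover: "\<Union>(range A) = UNIV"
  proof -
    have "\<exists>N. x \<in> A N" for x
    proof -
      obtain B where "\<And>n. norm (L n x) \<le> B"
        using bdd[of x] by (auto simp: bounded_iff)
      then have "norm (L n x) \<le> real (nat \<lceil>B\<rceil>)" for n
        by (meson order_trans real_nat_ceiling_ge)
      then show ?thesis by (auto simp: A_def)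
    qed
    then show ?thesis by blast
  qed
  obtain N where "interior (A N) \<noteq> {}"
  proof -
    have "\<exists>N. interior (A N) \<noteq> {}"
    proof (rule ccontr)
      assume "\<nexists>N. interior (A N) \<noteq> {}"
      then have "(euclidean :: 'a topology) interior_of (\<Union>(range A)) = {}"
        by (intro Baire_category_alt) (auto simp: completely_metrizable_space_euclidean closed)
      then show False by (simp add: cover)
    qed
    then show ?thesis using that by blast
  qed
  then obtain z r where r: "r > 0" "cball z r \<subseteq> A N"
    by (metis all_not_in_conv mem_interior_cball)
  have "norm (L n x) \<le> 2 * real N / r * norm x" for n x
  proof (cases "x = 0")
    case True
    then show ?thesis using lin[of n] by (simp add: bounded_linear.linear linear_0)
  next
    case False
    interpret bounded_linear "L n" by (rule lin)
    define v where "v = (r / norm x) *\<^sub>R x"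
    have "norm v = r" using False r by (simp add: v_def)
    then have "z + v \<in> A N" "z \<in> A N" using r by (auto simp: subset_iff dist_norm)
    then have "norm (L n (z + v)) \<le> N" "norm (L n z) \<le> N" by (auto simp: A_def)
    then have "norm (L n v) \<le> 2 * real N"
      using norm_triangle_ineq4[of "L n (z + v)" "L n z"] by (simp add: add)
    then show ?thesis
      using False r by (simp add: v_def scaleR field_simps)
  qed
  then show ?thesis using r by (intro exI[of _ "2 * real N / r"]) auto
qed

lemma C0_semigroupD:
  assumes "C0_semigroup T"
  shows "t \<ge> 0 \<Longrightarrow> bounded_linear (T t)" "T 0 x = x"
    "s \<ge> 0 \<Longrightarrow> t \<ge> 0 \<Longrightarrow> T (s + t) x = T s (T t x)"
    "((\<lambda>t. T t x) \<longlongrightarrow> x) (at_right 0)"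
  using assms by (auto simp: C0_semigroup_def)

text \<open>Otherwise there are times tending to 0 along which the operators \<open>T (t n)\<close>
  are not uniformly bounded, although they converge pointwise to the identity; this contradicts
  Banach-Steinhaus.\<close>

lemma C0_semigroup_bounded_near_0:
  fixes T :: "real \<Rightarrow> 'a::banach \<Rightarrow> 'a"
  assumes T: "C0_semigroup T"
  shows "\<exists>\<delta>>0. \<exists>M\<ge>0. \<forall>t\<in>{0..\<delta>}. \<forall>x. norm (T t x) \<le> M * norm x"
proof (rule ccontr)
  assume neg: "\<not> ?thesis"
  have "\<exists>t x. 0 \<le> t \<and> t \<le> 1 / real (Suc n) \<and> norm (T t x) > real n * norm x" for n
  proof (rule ccontr)
    assume "\<not> ?thesis"
    then have "\<forall>t\<in>{0..1 / real (Suc n)}. \<forall>x. norm (T t x) \<le> real n * norm x"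
      by (meson atLeastAtMost_iff not_le)
    then have "1 / real (Suc n) > 0 \<and> (\<exists>M\<ge>0. \<forall>t\<in>{0..1 / real (Suc n)}. \<forall>x. norm (T t x) \<le> M * norm x)"
      by (metis of_nat_0_le_iff of_nat_0_less_iff zero_less_Suc zero_less_divide_1_iff)
    then show False using neg by blast
  qed
  then obtain t x where tx: "\<And>n. 0 \<le> t n" "\<And>n. t n \<le> 1 / real (Suc n)"
    "\<And>n. norm (T (t n) (x n)) > real n * norm (x n)"
    by metis
  have t0: "t \<longlonglongrightarrow> 0"
  proof (rule tendsto_sandwich[OF _ _ tendsto_const LIMSEQ_inverse_real_of_nat])
    show "\<forall>\<^sub>F n in sequentially. t n \<le> inverse (real (Suc n))"
      using tx(2) by (simp add: inverse_eq_divide)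
  qed (use tx in auto)
  have lim: "(\<lambda>n. T (t n) v) \<longlonglongrightarrow> v" for v
  proof -
    \<comment> \<open>Some \<open>t n\<close> may equal 0, so the right-hand limit is first turned
      into continuity at 0 within the closed half-line.\<close>
    have "((\<lambda>s. T s v) \<longlongrightarrow> v) (at 0 within {0..})"
    proof -
      have "((\<lambda>s. T s v) \<longlongrightarrow> v) (at 0 within {0<..})"
        using C0_semigroupD(4)[OF T] by simp
      moreover have "at 0 within {0::real<..} = at 0 within {0..}"
        by (rule at_within_nhd[of _ UNIV]) auto
      ultimately show ?thesis by simp
    qed
    then have "continuous (at 0 within {0..}) (\<lambda>s. T s v)"
      by (simp add: continuous_within C0_semigroupD(2)[OF T])
    then show ?thesis
      using t0 tx(1) C0_semigroupD(2)[OF T, of v]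
      unfolding continuous_within_sequentially comp_def by auto
  qed
  obtain M where M: "\<And>n v. norm (T (t n) v) \<le> M * norm v"
    using uniform_boundedness_sequence[of "\<lambda>n. T (t n)"] C0_semigroupD(1)[OF T tx(1)]
      convergent_imp_bounded[OF lim] by blast
  obtain n where n: "real n > M" using reals_Archimedean2 by blast
  have "M * norm (x n) \<le> real n * norm (x n)" using n by (intro mult_right_mono) auto
  then show False using M[of n "x n"] tx(3)[of n] by linarith
qed

lemma C0_semigroup_bounded_on:
  fixes T :: "real \<Rightarrow> 'a::banach \<Rightarrow> 'a"
  assumes T: "C0_semigroup T"
  shows "\<exists>M>0. \<forall>t\<in>{0..\<tau>}. \<forall>x. norm (T t x) \<le> M * norm x"
proof -
  obtain \<delta> M where \<delta>: "\<delta> > 0" and M: "\<And>t x. 0 \<le> t \<Longrightarrow> t \<le> \<delta> \<Longrightarrow> norm (T t x) \<le> M * norm x"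
    using C0_semigroup_bounded_near_0[OF T] by (metis atLeastAtMost_iff)
  have *: "\<exists>K>0. \<forall>t\<in>{0..real n * \<delta>}. \<forall>x. norm (T t x) \<le> K * norm x" for n
  proof (induction n)
    case 0
    then show ?case by (intro exI[of _ 1]) (auto simp: C0_semigroupD(2)[OF T])
  next
    case (Suc n)
    then obtain K where K: "K > 0" "\<And>t x. 0 \<le> t \<Longrightarrow> t \<le> real n * \<delta> \<Longrightarrow> norm (T t x) \<le> K * norm x"
      by auto
    \<comment> \<open>The factor \<open>\<bar>M\<bar> + 1\<close> is at least 1, so the new constant
      still covers the times already treated and stays positive.\<close>
    have "norm (T t x) \<le> (K * (\<bar>M\<bar> + 1)) * norm x" if t: "0 \<le> t" "t \<le> real (Suc n) * \<delta>" for t x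
    proof (cases "t \<le> real n * \<delta>")
      case True
      have "K * norm x \<le> (K * (\<bar>M\<bar> + 1)) * norm x"
        using K by (intro mult_right_mono) auto
      then show ?thesis using K(2)[OF t(1) True, of x] by linarith
    next
      case False
      define s where "s = t - real n * \<delta>"
      have s: "0 \<le> s" "s \<le> \<delta>" using False t by (auto simp: s_def algebra_simps)
      have "T t x = T (real n * \<delta>) (T s x)"
        using C0_semigroupD(3)[OF T, of "real n * \<delta>" s x] s \<delta> by (simp add: s_def)
      then have "norm (T t x) \<le> K * norm (T s x)" using K(2) \<delta> by simp
      also have "\<dots> \<le> K * ((\<bar>M\<bar> + 1) * norm x)"
      proof (intro mult_left_mono)
        have "M * norm x \<le> (\<bar>M\<bar> + 1) * norm x" by (intro mult_right_mono) auto
        then show "norm (T s x) \<le> (\<bar>M\<bar> + 1) * norm x" using M[OF s, of x] by linarith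
      qed (use K in auto)
      finally show ?thesis by (simp add: mult.assoc)
    qed
    then show ?case using K(1) by (intro exI[of _ "K * (\<bar>M\<bar> + 1)"]) auto
  qed
  obtain n where "real n > \<tau> / \<delta>" using reals_Archimedean2 by blast
  then have "\<tau> \<le> real n * \<delta>" using \<delta> by (simp add: field_simps)
  then show ?thesis using *[of n] by force
qed

text \<open>For s below t the increment is \<open>T s\<close> applied to
  \<open>T (t - s) x - x\<close>, where the operator moves with s. A bound on \<open>T s\<close>
  uniform over a compact interval is what makes continuity from the left work.\<close>

lemma C0_semigroup_orbit_continuous:
  fixes T :: "real \<Rightarrow> 'a::banach \<Rightarrow> 'a"
  assumes T: "C0_semigroup T"
  shows "continuous_on {0..} (\<lambda>t. T t x)"
proof (rule iffD2[OF continuous_on_iff], intro ballI allI impI)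
  fix t e :: real assume t: "t \<in> {0..}" and e: "e > 0"
  obtain M where M: "M > 0" "\<And>s v. 0 \<le> s \<Longrightarrow> s \<le> t + 1 \<Longrightarrow> norm (T s v) \<le> M * norm v"
    using C0_semigroup_bounded_on[OF T, of "t + 1"] by auto
  have "\<forall>\<^sub>F h in at_right 0. dist (T h x) x < e / M"
    using C0_semigroupD(4)[OF T, of x] e M by (simp add: tendsto_iff)
  then obtain d where d: "d > 0" "\<And>h. 0 < h \<Longrightarrow> h < d \<Longrightarrow> norm (T h x - x) < e / M"
    unfolding eventually_at_right_field dist_norm by auto
  have close: "norm (T (s + h) x - T s x) < e" if "0 \<le> s" "s \<le> t + 1" "0 \<le> h" "h < d" for s h
  proof (cases "h = 0")
    case False
    interpret bounded_linear "T s" using C0_semigroupD(1)[OF T that(1)] .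
    have "T (s + h) x - T s x = T s (T h x - x)"
      using that C0_semigroupD(3)[OF T] by (simp add: diff)
    then have "norm (T (s + h) x - T s x) \<le> M * norm (T h x - x)" using M(2) that by simp
    also have "\<dots> < M * (e / M)"
      using M(1) d(2)[of h] that False by (intro mult_strict_left_mono) auto
    finally show ?thesis using M by simp
  qed (use e in simp)
  show "\<exists>d>0. \<forall>t'\<in>{0..}. dist t' t < d \<longrightarrow> dist (T t' x) (T t x) < e"
  proof (intro exI[of _ "min d 1"] conjI ballI impI)
    fix s assume s: "s \<in> {0..}" "dist s t < min d 1"
    then show "dist (T s x) (T t x) < e"
      using close[of s "t - s"] close[of t "s - t"] t
      by (cases "s \<le> t") (auto simp: dist_norm norm_minus_commute)
  qed (use d in auto)
qed

text \<open>\<open>T t\<close> commutes with the difference quotient, so the quotient at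
  \<open>T t x\<close> converges to \<open>T t (G x)\<close>; the equivalence in
  \<open>generates\<close> then yields both claims together.\<close>

lemma generates_invariant:
  fixes T :: "real \<Rightarrow> 'a::banach \<Rightarrow> 'a"
  assumes gen: "generates D G T" and x: "x \<in> D" and t: "t \<ge> 0"
  shows "T t x \<in> D" "G (T t x) = T t (G x)"
proof -
  have T: "C0_semigroup T" using gen by (simp add: generates_def)
  interpret bounded_linear "T t" using C0_semigroupD(1)[OF T t] .
  have "((\<lambda>h. (T h x - x) /\<^sub>R h) \<longlongrightarrow> G x) (at_right 0)"
    using gen x by (simp add: generates_def)
  then have "((\<lambda>h. T t ((T h x - x) /\<^sub>R h)) \<longlongrightarrow> T t (G x)) (at_right 0)"
    by (rule tendsto)
  moreover have "\<forall>\<^sub>F h in at_right 0. T t ((T h x - x) /\<^sub>R h) = (T h (T t x) - T t x) /\<^sub>R h"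
  proof -
    have "T t ((T h x - x) /\<^sub>R h) = (T h (T t x) - T t x) /\<^sub>R h" if "h > 0" for h
      using that t C0_semigroupD(3)[OF T, of t h x] C0_semigroupD(3)[OF T, of h t x]
      by (simp add: scaleR diff add.commute)
    then show ?thesis by (auto simp: eventually_at_filter)
  qed
  ultimately have "((\<lambda>h. (T h (T t x) - T t x) /\<^sub>R h) \<longlongrightarrow> T t (G x)) (at_right 0)"
    by (rule Lim_transform_eventually)
  then show "T t x \<in> D" "G (T t x) = T t (G x)"
    using gen by (auto simp: generates_def)
qed

text \<open>\<open>generates\<close> speaks only of right difference quotients at 0. To the right of
  t the fixed operator \<open>T t\<close> transports the error term. To the left the operator
  \<open>T s\<close> moves: it is bounded uniformly up to t, and continuity of the orbit of
  \<open>G x\<close> replaces \<open>T s (G x)\<close> by \<open>T t (G x)\<close>.\<close>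

lemma generates_orbit_derivative:
  fixes T :: "real \<Rightarrow> 'a::banach \<Rightarrow> 'a"
  assumes gen: "generates D G T" and x: "x \<in> D" and t: "t \<ge> 0"
  shows "((\<lambda>t. T t x) has_vector_derivative G (T t x)) (at t within {0..})"
proof -
  have T: "C0_semigroup T" using gen by (simp add: generates_def)
  obtain M where M: "M > 0" "\<And>s v. 0 \<le> s \<Longrightarrow> s \<le> t \<Longrightarrow> norm (T s v) \<le> M * norm v"
    using C0_semigroup_bounded_on[OF T, of t] by auto
  define err where "err h = T h x - x - h *\<^sub>R G x" for h
  have err: "\<exists>d>0. \<forall>h. 0 \<le> h \<and> h < d \<longrightarrow> norm (err h) \<le> e * h" if e: "e > 0" for e
  proof -
    have "((\<lambda>h. (T h x - x) /\<^sub>R h) \<longlongrightarrow> G x) (at_right 0)"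
      using gen x by (simp add: generates_def)
    then have "\<forall>\<^sub>F h in at_right 0. dist ((T h x - x) /\<^sub>R h) (G x) < e"
      using e by (simp add: tendsto_iff)
    then obtain d where d: "d > 0" "\<And>h. 0 < h \<Longrightarrow> h < d \<Longrightarrow> norm ((T h x - x) /\<^sub>R h - G x) < e"
      unfolding eventually_at_right_field dist_norm by auto
    have "norm (err h) \<le> e * h" if h: "0 \<le> h" "h < d" for h
    proof (cases "h = 0")
      case False
      have "err h = h *\<^sub>R ((T h x - x) /\<^sub>R h - G x)"
        using False by (simp add: err_def scaleR_right_diff_distrib)
      then have "norm (err h) = norm ((T h x - x) /\<^sub>R h - G x) * h" using h by simp
      also have "\<dots> \<le> e * h" using d(2)[of h] h False by (intro mult_right_mono) auto
      finally show ?thesis .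
    qed (simp add: err_def C0_semigroupD(2)[OF T])
    then show ?thesis using d(1) by blast
  qed
  have "\<exists>d>0. \<forall>s\<in>{0..}. norm (s - t) < d \<longrightarrow>
      norm (T s x - T t x - (s - t) *\<^sub>R G (T t x)) \<le> e * norm (s - t)" if e: "e > 0" for e
  proof -
    \<comment> \<open>The M in \<open>e / (2 * M)\<close> absorbs the operator bound, and the 2
      leaves half of e for the variation of \<open>T s (G x)\<close>.\<close>
    obtain d1 where d1: "d1 > 0" "\<And>h. 0 \<le> h \<Longrightarrow> h < d1 \<Longrightarrow> norm (err h) \<le> e / (2 * M) * h"
      using err[of "e / (2 * M)"] e M by auto
    obtain d2 where d2: "d2 > 0"
      "\<And>s. s \<ge> 0 \<Longrightarrow> dist s t < d2 \<Longrightarrow> dist (T s (G x)) (T t (G x)) < e / 2"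
      using C0_semigroup_orbit_continuous[OF T, of "G x"] t e
      unfolding continuous_on_iff by (metis atLeast_iff half_gt_zero)
    have M_err: "norm (T s (err h)) \<le> e / 2 * h" if "0 \<le> s" "s \<le> t" "0 \<le> h" "h < d1" for s h
    proof -
      have "norm (T s (err h)) \<le> M * (e / (2 * M) * h)"
        using M(2)[OF that(1,2), of "err h"] mult_left_mono[OF d1(2)[OF that(3,4)], of M] M(1)
        by linarith
      then show ?thesis using M(1) by simp
    qed
    have "norm (T s x - T t x - (s - t) *\<^sub>R G (T t x)) \<le> e * norm (s - t)"
      if s: "s \<ge> 0" "norm (s - t) < min d1 d2" for s
    proof (cases "t \<le> s")
      case True
      interpret bounded_linear "T t" using C0_semigroupD(1)[OF T t] .
      have "T s x = T t (T (s - t) x)"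
        using C0_semigroupD(3)[OF T t, of "s - t" x] True by simp
      then have "T s x - T t x - (s - t) *\<^sub>R G (T t x) = T t (err (s - t))"
        by (simp add: err_def diff scaleR generates_invariant(2)[OF gen x t])
      moreover have "norm (T t (err (s - t))) \<le> e / 2 * (s - t)"
        using M_err[of t "s - t"] s True t by simp
      moreover have "e / 2 * (s - t) \<le> e * (s - t)" using True e by (intro mult_right_mono) auto
      ultimately show ?thesis using True by simp
    next
      case False
      interpret bounded_linear "T s" using C0_semigroupD(1)[OF T s(1)] .
      have "T t x = T s (T (t - s) x)"
        using C0_semigroupD(3)[OF T s(1), of "t - s" x] False by simp
      then have Ts: "T s (T (t - s) x) = T t x" by simp
      have eq: "T s x - T t x - (s - t) *\<^sub>R G (T t x)
          = (t - s) *\<^sub>R (T t (G x) - T s (G x)) - T s (err (t - s))"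
        unfolding err_def diff scaleR Ts generates_invariant(2)[OF gen x t]
        by (simp add: algebra_simps)
      have "norm ((t - s) *\<^sub>R (T t (G x) - T s (G x))) \<le> (t - s) * (e / 2)"
        using d2(2)[OF s(1)] s False
        by (auto simp: dist_norm norm_minus_commute intro!: mult_left_mono)
      moreover have "norm (T s (err (t - s))) \<le> e / 2 * (t - s)"
        using M_err[of s "t - s"] s False by simp
      ultimately have "norm (T s x - T t x - (s - t) *\<^sub>R G (T t x)) \<le> (t - s) * (e / 2) + e / 2 * (t - s)"
        unfolding eq by (meson add_mono norm_triangle_ineq4 order_trans)
      then show ?thesis using False by (simp add: field_simps)
    qed
    then show ?thesis using d1 d2 by (intro exI[of _ "min d1 d2"]) auto
  qed
  then show ?thesis
    unfolding has_vector_derivative_def has_derivative_within_alt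
    using bounded_linear_scaleR_left by auto
qed

section \<open>The rotation group\<close>

instance ell2 :: banach ..

lemma norm_state_sq: "(norm z)\<^sup>2 = (\<Sum>j. (coord (fst z) j)\<^sup>2 + (coord (snd z) j)\<^sup>2)" for z :: state
proof -
  have "(norm z)\<^sup>2 = (norm (fst z))\<^sup>2 + (norm (snd z))\<^sup>2"
    by (simp add: norm_prod_def)
  then show ?thesis
    by (simp add: norm_ell2_sq suminf_add summable_coord_sq)
qed

lemma summable_state_sq: "summable (\<lambda>j. (coord (fst z) j)\<^sup>2 + (coord (snd z) j)\<^sup>2)" for z :: state
  by (intro summable_add summable_coord_sq)

lemma state_eqI:
  "(\<And>j. coord (fst z) j = coord (fst w) j) \<Longrightarrow> (\<And>j. coord (snd z) j = coord (snd w) j) \<Longrightarrow> z = w"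
  for z w :: state
  by (intro prod_eqI ell2_eqI)

lemma bounded_linear_coord: "bounded_linear (\<lambda>x. coord x j)"
  by (rule bounded_linear_intro[of _ 1]) (simp_all add: abs_coord_le)

text \<open>Dominated convergence in the state space: the squared distance is a series with majorant
  M, so Tannery's theorem allows the limit to be taken coordinate by coordinate.\<close>

lemma state_tendsto_dominated:
  fixes Z :: "'i \<Rightarrow> state"
  assumes fst: "\<And>j. ((\<lambda>t. coord (fst (Z t)) j) \<longlongrightarrow> coord (fst z) j) F"
    and snd: "\<And>j. ((\<lambda>t. coord (snd (Z t)) j) \<longlongrightarrow> coord (snd z) j) F"
    and dom: "\<And>t j. (coord (fst (Z t - z)) j)\<^sup>2 + (coord (snd (Z t - z)) j)\<^sup>2 \<le> M j"
    and M: "summable M"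
  shows "(Z \<longlongrightarrow> z) F"
proof (cases "F = bot")
  case False
  define a where "a j t = (coord (fst (Z t - z)) j)\<^sup>2 + (coord (snd (Z t - z)) j)\<^sup>2" for j t
  have "((\<lambda>t. \<Sum>j. a j t) \<longlongrightarrow> (\<Sum>j. 0)) F"
  proof (rule conjunct2[OF conjunct2[OF tannerys_theorem[OF _ _ M False]]])
    fix j
    have "((\<lambda>t. (coord (fst (Z t)) j - coord (fst z) j)\<^sup>2 + (coord (snd (Z t)) j - coord (snd z) j)\<^sup>2)
        \<longlongrightarrow> (coord (fst z) j - coord (fst z) j)\<^sup>2 + (coord (snd z) j - coord (snd z) j)\<^sup>2) F"
      by (intro tendsto_intros fst snd)
    then show "((\<lambda>t. a j t) \<longlongrightarrow> 0) F" by (simp add: a_def)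
  next
    show "\<forall>\<^sub>F (j, t) in sequentially \<times>\<^sub>F F. norm (a j t) \<le> M j"
      using dom by (intro always_eventually) (auto simp: a_def)
  qed
  then have "((\<lambda>t. (norm (Z t - z))\<^sup>2) \<longlongrightarrow> 0) F"
    by (simp add: a_def norm_state_sq)
  then have "((\<lambda>t. sqrt ((norm (Z t - z))\<^sup>2)) \<longlongrightarrow> sqrt 0) F"
    by (rule tendsto_real_sqrt)
  then have "((\<lambda>t. norm (Z t - z)) \<longlongrightarrow> 0) F" by simp
  then show ?thesis by (rule LIM_zero_cancel[OF tendsto_norm_zero_cancel])
qed simp

text \<open>The group exp (t A) written mode by mode: the complex number \<xi>_j + i \<eta>_j is
  multiplied by exp (-i \<omega>_j t).\<close>

definition rotation :: "(nat \<Rightarrow> real) \<Rightarrow> real \<Rightarrow> state \<Rightarrow> state" where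
  "rotation \<omega> t z =
    (Ell2 (\<lambda>j. cos (\<omega> j * t) * coord (fst z) j + sin (\<omega> j * t) * coord (snd z) j),
     Ell2 (\<lambda>j. cos (\<omega> j * t) * coord (snd z) j - sin (\<omega> j * t) * coord (fst z) j))"

lemma summable_bounded_scale_sq:
  fixes a x :: "nat \<Rightarrow> real"
  assumes "\<And>j. \<bar>a j\<bar> \<le> 1" "summable (\<lambda>j. (x j)\<^sup>2)"
  shows "summable (\<lambda>j. (a j * x j)\<^sup>2)"
proof (rule summable_comparison_test'[OF assms(2), where N = 0])
  show "norm ((a j * x j)\<^sup>2) \<le> (x j)\<^sup>2" for j
    using mult_right_mono[of "(a j)\<^sup>2" 1 "(x j)\<^sup>2"] abs_square_le_1[of "a j"] assms(1)[of j]
    by (simp add: power_mult_distrib)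
qed

lemma coord_rotation [simp]:
  "coord (fst (rotation \<omega> t z)) j = cos (\<omega> j * t) * coord (fst z) j + sin (\<omega> j * t) * coord (snd z) j"
  "coord (snd (rotation \<omega> t z)) j = cos (\<omega> j * t) * coord (snd z) j - sin (\<omega> j * t) * coord (fst z) j"
proof -
  have s: "summable (\<lambda>j. (cos (\<omega> j * t) * coord x j)\<^sup>2)"
      "summable (\<lambda>j. (sin (\<omega> j * t) * coord x j)\<^sup>2)" "summable (\<lambda>j. (- sin (\<omega> j * t) * coord x j)\<^sup>2)"
    for x
    by (intro summable_bounded_scale_sq summable_coord_sq; simp)+
  show "coord (fst (rotation \<omega> t z)) j = cos (\<omega> j * t) * coord (fst z) j + sin (\<omega> j * t) * coord (snd z) j"
    by (simp add: rotation_def coord_Ell2 summable_add_sq s)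
  show "coord (snd (rotation \<omega> t z)) j = cos (\<omega> j * t) * coord (snd z) j - sin (\<omega> j * t) * coord (fst z) j"
    using summable_add_sq[OF s(1)[of "snd z"] s(3)[of "fst z"]]
    by (simp add: rotation_def coord_Ell2)
qed

text \<open>The modulus of a product of complex numbers. Since c and s are arbitrary, it gives the
  isometry property and also the majorants for a rotation minus the identity and for difference
  quotients.\<close>

lemma rotation_sq:
  fixes c s a b :: real
  shows "(c * a + s * b)\<^sup>2 + (c * b - s * a)\<^sup>2 = (c\<^sup>2 + s\<^sup>2) * (a\<^sup>2 + b\<^sup>2)"
  by (simp add: power2_eq_square algebra_simps)

lemma norm_rotation: "norm (rotation \<omega> t z) = norm z"
proof -
  have "(norm (rotation \<omega> t z))\<^sup>2 = (norm z)\<^sup>2"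
    by (simp add: norm_state_sq rotation_sq)
  then show ?thesis by simp
qed

lemma tendsto_difference_quotient_0:
  fixes f :: "real \<Rightarrow> real"
  assumes "(f has_real_derivative D) (at 0)"
  shows "((\<lambda>h. (f h - f 0) / h) \<longlongrightarrow> D) (at_right 0)"
proof -
  have "((\<lambda>h. (f h - f 0) / h) \<longlongrightarrow> D) (at 0)"
    using assms by (simp add: DERIV_def)
  then show ?thesis by (rule tendsto_within_subset) simp
qed

lemma abs_cos_diff_one_le: "\<bar>cos x - 1\<bar> \<le> \<bar>x\<bar>" for x :: real
proof -
  have "1 - cos x = 2 * (sin (x / 2))\<^sup>2" using cos_double_sin[of "x / 2"] by simp
  also have "\<dots> = 2 * (\<bar>sin (x / 2)\<bar> * \<bar>sin (x / 2)\<bar>)" by (simp add: power2_eq_square)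
  also have "\<dots> \<le> 2 * (\<bar>x / 2\<bar> * 1)"
    by (intro mult_left_mono mult_mono abs_sin_x_le_abs_x) auto
  finally show ?thesis using cos_le_one[of x] by simp
qed

lemma isometry_group_rotation: "isometry_group (rotation \<omega>)"
proof
  fix s t :: real and x y :: state and r :: real
  show "rotation \<omega> t (x + y) = rotation \<omega> t x + rotation \<omega> t y"
    by (rule state_eqI) (simp_all add: algebra_simps)
  show "rotation \<omega> t (r *\<^sub>R x) = r *\<^sub>R rotation \<omega> t x"
    by (rule state_eqI) (simp_all add: algebra_simps)
  show "rotation \<omega> (s + t) x = rotation \<omega> s (rotation \<omega> t x)"
    by (rule state_eqI) (simp_all add: algebra_simps cos_add sin_add)
  show "norm (rotation \<omega> t x) = norm x" by (rule norm_rotation)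
  show "((\<lambda>t. rotation \<omega> t x) \<longlongrightarrow> x) (at_right 0)"
  proof (rule state_tendsto_dominated)
    fix j
    have "((\<lambda>t. cos (\<omega> j * t) * coord (fst x) j + sin (\<omega> j * t) * coord (snd x) j) \<longlongrightarrow>
        cos (\<omega> j * 0) * coord (fst x) j + sin (\<omega> j * 0) * coord (snd x) j) (at_right 0)"
      by (intro tendsto_intros)
    then show "((\<lambda>t. coord (fst (rotation \<omega> t x)) j) \<longlongrightarrow> coord (fst x) j) (at_right 0)" by simp
    have "((\<lambda>t. cos (\<omega> j * t) * coord (snd x) j - sin (\<omega> j * t) * coord (fst x) j) \<longlongrightarrow>
        cos (\<omega> j * 0) * coord (snd x) j - sin (\<omega> j * 0) * coord (fst x) j) (at_right 0)"
      by (intro tendsto_intros)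
    then show "((\<lambda>t. coord (snd (rotation \<omega> t x)) j) \<longlongrightarrow> coord (snd x) j) (at_right 0)" by simp
  next
    fix t j
    define c where "c = cos (\<omega> j * t) - 1"
    define s where "s = sin (\<omega> j * t)"
    \<comment> \<open>These bounds give the constant 5 = 2^2 + 1^2 of the majorant.\<close>
    have "\<bar>c\<bar> \<le> \<bar>2\<bar>" "\<bar>s\<bar> \<le> \<bar>1\<bar>"
      using cos_ge_minus_one[of "\<omega> j * t"] cos_le_one[of "\<omega> j * t"]
      by (auto simp: c_def s_def)
    then have "c\<^sup>2 \<le> 2\<^sup>2" "s\<^sup>2 \<le> 1\<^sup>2" by (simp_all only: abs_le_square_iff)
    then have "(c\<^sup>2 + s\<^sup>2) * ((coord (fst x) j)\<^sup>2 + (coord (snd x) j)\<^sup>2)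
        \<le> 5 * ((coord (fst x) j)\<^sup>2 + (coord (snd x) j)\<^sup>2)"
      by (intro mult_right_mono) auto
    then show "(coord (fst (rotation \<omega> t x - x)) j)\<^sup>2 + (coord (snd (rotation \<omega> t x - x)) j)\<^sup>2
        \<le> 5 * ((coord (fst x) j)\<^sup>2 + (coord (snd x) j)\<^sup>2)"
      unfolding rotation_sq[symmetric] by (simp add: c_def s_def algebra_simps)
  next
    show "summable (\<lambda>j. 5 * ((coord (fst x) j)\<^sup>2 + (coord (snd x) j)\<^sup>2))"
      by (intro summable_mult summable_state_sq)
  qed
qed

lemma coord_op_A:
  assumes "z \<in> dom_A \<omega>"
  shows "coord (fst (op_A \<omega> z)) j = \<omega> j * coord (snd z) j"
    and "coord (snd (op_A \<omega> z)) j = - \<omega> j * coord (fst z) j"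
proof -
  obtain \<xi> \<eta> where z: "z = (\<xi>, \<eta>)" by fastforce
  note \<Omega> = coord_op_Omega[OF assms[unfolded z]]
  show "coord (fst (op_A \<omega> z)) j = \<omega> j * coord (snd z) j"
    "coord (snd (op_A \<omega> z)) j = - \<omega> j * coord (fst z) j"
    by (simp_all add: z op_A_def \<Omega>)
qed

lemma C0_semigroup_isometry_group:
  assumes "isometry_group S"
  shows "C0_semigroup S"
proof -
  interpret isometry_group S by fact
  show ?thesis
    unfolding C0_semigroup_def
    by (intro conjI allI impI ext bounded_linear_S S_at_right) (simp_all add: S_add)
qed

text \<open>Coordinatewise the quotients converge for every x, to what A should give. If they
  converge in the state space, square summability of the limit forces x into the domain. Conversely,
  membership in the domain is exactly the summability of the majorant needed for dominated
  convergence.\<close>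

lemma generates_rotation: "generates (dom_A \<omega>) (op_A \<omega>) (rotation \<omega>)"
  unfolding generates_def
proof (intro conjI allI iffI C0_semigroup_isometry_group isometry_group_rotation)
  fix x y :: state
  have quot: "((\<lambda>h. coord (fst ((rotation \<omega> h x - x) /\<^sub>R h)) j) \<longlongrightarrow> \<omega> j * coord (snd x) j) (at_right 0)"
    "((\<lambda>h. coord (snd ((rotation \<omega> h x - x) /\<^sub>R h)) j) \<longlongrightarrow> - \<omega> j * coord (fst x) j) (at_right 0)" for j
  proof -
    have "((\<lambda>t. cos (\<omega> j * t) * coord (fst x) j + sin (\<omega> j * t) * coord (snd x) j)
        has_real_derivative \<omega> j * coord (snd x) j) (at 0)"
      by (auto intro!: derivative_eq_intros)
    from tendsto_difference_quotient_0[OF this]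
    show "((\<lambda>h. coord (fst ((rotation \<omega> h x - x) /\<^sub>R h)) j) \<longlongrightarrow> \<omega> j * coord (snd x) j) (at_right 0)"
      by (simp add: divide_inverse_commute)
    have "((\<lambda>t. cos (\<omega> j * t) * coord (snd x) j - sin (\<omega> j * t) * coord (fst x) j)
        has_real_derivative - \<omega> j * coord (fst x) j) (at 0)"
      by (auto intro!: derivative_eq_intros)
    from tendsto_difference_quotient_0[OF this]
    show "((\<lambda>h. coord (snd ((rotation \<omega> h x - x) /\<^sub>R h)) j) \<longlongrightarrow> - \<omega> j * coord (fst x) j) (at_right 0)"
      by (simp add: divide_inverse_commute)
  qed
  {
    assume lim: "((\<lambda>h. (rotation \<omega> h x - x) /\<^sub>R h) \<longlongrightarrow> y) (at_right 0)"
    have y: "coord (fst y) j = \<omega> j * coord (snd x) j" "coord (snd y) j = - \<omega> j * coord (fst x) j" for j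
      using tendsto_unique[OF _ bounded_linear.tendsto[OF bounded_linear_coord tendsto_fst[OF lim]] quot(1)]
        tendsto_unique[OF _ bounded_linear.tendsto[OF bounded_linear_coord tendsto_snd[OF lim]] quot(2)]
      by simp_all
    have "summable (\<lambda>j. (\<omega> j)\<^sup>2 * ((coord (fst x) j)\<^sup>2 + (coord (snd x) j)\<^sup>2))"
      using summable_state_sq[of y] by (simp add: y power_mult_distrib algebra_simps)
    then show D: "x \<in> dom_A \<omega>" by (simp add: dom_A_def case_prod_beta)
    show "y = op_A \<omega> x"
      by (rule state_eqI) (simp_all add: y coord_op_A[OF D])
  }
  assume "x \<in> dom_A \<omega> \<and> y = op_A \<omega> x"
  then have D: "x \<in> dom_A \<omega>" and y: "y = op_A \<omega> x" by auto
  \<comment> \<open>The majorant must hold for every h, so for h <= 0 the quotient is replaced by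
    its intended limit; the right-hand limit does not see this.\<close>
  have "((\<lambda>h. if h > 0 then (rotation \<omega> h x - x) /\<^sub>R h else y) \<longlongrightarrow> y) (at_right 0)"
  proof (rule state_tendsto_dominated)
    fix j
    have ev: "\<forall>\<^sub>F h in at_right 0. f ((rotation \<omega> h x - x) /\<^sub>R h)
        = f (if h > 0 then (rotation \<omega> h x - x) /\<^sub>R h else y)" for f :: "state \<Rightarrow> real"
      by (auto simp: eventually_at_filter)
    show "((\<lambda>h. coord (fst (if h > 0 then (rotation \<omega> h x - x) /\<^sub>R h else y)) j) \<longlongrightarrow> coord (fst y) j)
        (at_right 0)"
      using Lim_transform_eventually[OF quot(1) ev[of "\<lambda>z. coord (fst z) j"]]
      by (simp add: y coord_op_A[OF D])
    show "((\<lambda>h. coord (snd (if h > 0 then (rotation \<omega> h x - x) /\<^sub>R h else y)) j) \<longlongrightarrow> coord (snd y) j)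
        (at_right 0)"
      using Lim_transform_eventually[OF quot(2) ev[of "\<lambda>z. coord (snd z) j"]]
      by (simp add: y coord_op_A[OF D])
  next
    fix h :: real and j
    let ?w = "if h > 0 then (rotation \<omega> h x - x) /\<^sub>R h else y"
    let ?E = "(coord (fst x) j)\<^sup>2 + (coord (snd x) j)\<^sup>2"
    show "(coord (fst (?w - y)) j)\<^sup>2 + (coord (snd (?w - y)) j)\<^sup>2 \<le> 5 * ((\<omega> j)\<^sup>2 * ?E)"
    proof (cases "h > 0")
      case True
      \<comment> \<open>The error has again the form of \<open>rotation_sq\<close>, and |c| <=
        |\<omega>_j| and |s| <= 2 |\<omega>_j| give the factor 5 \<omega>_j^2.\<close>
      define c where "c = (cos (\<omega> j * h) - 1) / h"
      define s where "s = sin (\<omega> j * h) / h - \<omega> j"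
      have "\<bar>c\<bar> \<le> \<bar>\<omega> j\<bar>"
        using abs_cos_diff_one_le[of "\<omega> j * h"] True by (simp add: c_def abs_mult field_simps)
      moreover have "\<bar>s\<bar> \<le> \<bar>2 * \<omega> j\<bar>"
      proof -
        have "\<bar>sin (\<omega> j * h) / h\<bar> \<le> \<bar>\<omega> j\<bar>"
          using abs_sin_x_le_abs_x[of "\<omega> j * h"] True by (simp add: abs_mult field_simps)
        then show ?thesis unfolding s_def by linarith
      qed
      ultimately have "c\<^sup>2 + s\<^sup>2 \<le> 5 * (\<omega> j)\<^sup>2"
        unfolding abs_le_square_iff by (simp add: power_mult_distrib)
      then have "(c\<^sup>2 + s\<^sup>2) * ?E \<le> 5 * (\<omega> j)\<^sup>2 * ?E"
        by (intro mult_right_mono) auto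
      moreover have w: "coord (fst (?w - y)) j = c * coord (fst x) j + s * coord (snd x) j"
        "coord (snd (?w - y)) j = c * coord (snd x) j - s * coord (fst x) j"
        using True by (simp_all add: y coord_op_A[OF D] c_def s_def field_simps)
      ultimately show ?thesis unfolding w rotation_sq by (simp add: mult.assoc)
    qed simp
  next
    show "summable (\<lambda>j. 5 * ((\<omega> j)\<^sup>2 * ((coord (fst x) j)\<^sup>2 + (coord (snd x) j)\<^sup>2)))"
      using D by (intro summable_mult) (simp add: dom_A_def case_prod_beta)
  qed
  then show "((\<lambda>h. (rotation \<omega> h x - x) /\<^sub>R h) \<longlongrightarrow> y) (at_right 0)"
    by (rule Lim_transform_eventually) (auto simp: eventually_at_filter)
qed

section \<open>Decay of observed oscillators\<close>

lemma has_vector_derivative_bound: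
  fixes f :: "real \<Rightarrow> 'a::real_normed_vector"
  assumes S: "convex S"
    and f: "\<And>x. x \<in> S \<Longrightarrow> (f has_vector_derivative f' x) (at x within S)"
    and B: "\<And>x. x \<in> S \<Longrightarrow> norm (f' x) \<le> B"
    and "x \<in> S" "y \<in> S"
  shows "norm (f x - f y) \<le> B * \<bar>x - y\<bar>"
proof -
  have "onorm (\<lambda>h. h *\<^sub>R f' x) \<le> B" if "x \<in> S" for x
  proof (rule onorm_bound)
    show "0 \<le> B" by (rule order_trans[OF norm_ge_zero B[OF that]])
    show "norm (h *\<^sub>R f' x) \<le> B * norm h" for h
      using mult_right_mono[OF B[OF that], of "\<bar>h\<bar>"] by (simp add: mult.commute)
  qed
  then show ?thesis
    using differentiable_bound[OF S, of f "\<lambda>x h. h *\<^sub>R f' x" B x y] assms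
    by (auto simp: has_vector_derivative_def)
qed

text \<open>A version of Barbalat's lemma: each time \<open>y\<close> returns to a fixed size, the Lipschitz bound keeps
  it large long enough to cost a fixed amount of \<open>E\<close>.\<close>

lemma dissipated_output_tendsto_0:
  fixes E y :: "real \<Rightarrow> real"
  assumes E_nonneg: "\<And>t. t \<ge> 0 \<Longrightarrow> E t \<ge> 0"
    and E: "\<And>t. t \<ge> 0 \<Longrightarrow> (E has_real_derivative E' t) (at t within {0..})"
    and E': "\<And>t. t \<ge> 0 \<Longrightarrow> E' t \<le> - k * (y t)\<^sup>2"
    and k: "k > 0"
    and y: "\<And>s t. s \<ge> 0 \<Longrightarrow> t \<ge> 0 \<Longrightarrow> \<bar>y s - y t\<bar> \<le> L * \<bar>s - t\<bar>"
  shows "(y \<longlongrightarrow> 0) at_top"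
proof (rule tendstoI)
  fix e :: real assume e: "e > 0"
  \<comment> \<open>Time during which the output can change by at most e/2; adding 1 keeps the
    denominator positive for every real L.\<close>
  define h where "h = e / 2 / (\<bar>L\<bar> + 1)"
  have L1: "\<bar>L\<bar> + 1 > 0" by linarith
  then have "h > 0" using e by (simp add: h_def)
  moreover have "(\<bar>L\<bar> + 1) * h = e / 2"
    unfolding h_def using nonzero_mult_div_cancel_left[of "\<bar>L\<bar> + 1" "e / 2"] L1
    by (metis less_irrefl times_divide_eq_right)
  then have "\<bar>L\<bar> * h + h = e / 2" by (simp add: distrib_right)
  ultimately have h: "h > 0" "\<bar>L\<bar> * h \<le> e / 2" by linarith+
  \<comment> \<open>Energy lost over a window of length h on which the output is at least e/2 in
    absolute value.\<close>
  define \<delta> where "\<delta> = k * (e / 2)\<^sup>2 * h"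
  have \<delta>: "\<delta> > 0" using k e h by (simp add: \<delta>_def)
  have mvt: "\<exists>\<xi>\<in>{s<..<t}. E t - E s = E' \<xi> * (t - s)" if "0 \<le> s" "s < t" for s t
  proof (rule mvt_simple[OF \<open>s < t\<close>])
    fix r assume "s \<le> r" "r \<le> t"
    then have "(E has_real_derivative E' r) (at r within {s..t})"
      using that by (intro DERIV_subset[OF E]) auto
    then show "(E has_derivative (*) (E' r)) (at r within {s..t})"
      by (simp add: has_field_derivative_def)
  qed
  have decr: "E t \<le> E s" if "0 \<le> s" "s \<le> t" for s t
  proof (cases "s = t")
    case False
    then obtain \<xi> where \<xi>: "\<xi> > s" "E t - E s = E' \<xi> * (t - s)" using mvt[of s t] \<open>0 \<le> s\<close> \<open>s \<le> t\<close> by auto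
    have "0 \<le> k * (y \<xi>)\<^sup>2" using k by simp
    moreover have "E' \<xi> \<le> - k * (y \<xi>)\<^sup>2" using \<xi>(1) that by (intro E') simp
    ultimately have "E' \<xi> \<le> 0" by simp
    then show ?thesis using \<xi>(2) that mult_nonpos_nonneg[of "E' \<xi>" "t - s"] by simp
  qed simp
  \<comment> \<open>Once the energy is within \<open>\<delta>\<close> of its infimum, another loss
    of \<open>\<delta>\<close> is impossible, so no later time can have an output of size e.\<close>
  define m where "m = Inf (E ` {0..})"
  have bdd: "bdd_below (E ` {0..})" using E_nonneg by (auto intro: bdd_belowI[of _ 0])
  have "m < m + \<delta>" using \<delta> by simp
  then obtain t0 where t0: "t0 \<ge> 0" "E t0 < m + \<delta>"
    unfolding m_def by (subst (asm) (1) cInf_less_iff[OF _ bdd]) auto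
  have "\<bar>y t\<bar> < e" if t: "t \<ge> t0" for t
  proof (rule ccontr)
    assume "\<not> \<bar>y t\<bar> < e"
    then have yt: "\<bar>y t\<bar> \<ge> e" by simp
    have t_nonneg: "t \<ge> 0" using t t0 by simp
    obtain \<xi> where \<xi>: "\<xi> > t" "\<xi> < t + h" "E (t + h) - E t = E' \<xi> * h"
      using mvt[of t "t + h"] t_nonneg h by auto
    have "\<bar>y \<xi> - y t\<bar> \<le> L * \<bar>\<xi> - t\<bar>" using \<xi>(1) t_nonneg by (intro y) simp_all
    also have "\<dots> \<le> \<bar>L\<bar> * h" using \<xi> by (intro mult_mono) auto
    finally have "\<bar>y \<xi>\<bar> \<ge> \<bar>e / 2\<bar>" using h yt e by linarith
    then have "(e / 2)\<^sup>2 \<le> (y \<xi>)\<^sup>2" by (simp only: abs_le_square_iff)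
    then have "k * (e / 2)\<^sup>2 \<le> k * (y \<xi>)\<^sup>2" using k by (intro mult_left_mono) auto
    then have "E' \<xi> \<le> - (k * (e / 2)\<^sup>2)" using E'[of \<xi>] \<xi>(1) t_nonneg by simp
    then have "E' \<xi> * h \<le> - (k * (e / 2)\<^sup>2) * h" using h by (intro mult_right_mono) auto
    then have "E (t + h) \<le> E t - \<delta>" using \<xi>(3) by (simp add: \<delta>_def)
    also have "\<dots> < m" using decr[OF t0(1) t] t0(2) by simp
    also have "m \<le> E (t + h)" unfolding m_def using bdd t_nonneg h by (intro cInf_lower) auto
    finally show False by simp
  qed
  then show "\<forall>\<^sub>F t in at_top. dist (y t) 0 < e"
    by (auto simp: eventually_at_top_linorder intro!: exI[of _ t0])
qed

text \<open>Compare the increment of \<open>\<Psi>\<close>, which is bounded, with that of \<open>\<lambda>s. (s - t) *\<^sub>R p t\<close> over a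
  window long enough to make the former negligible.\<close>

lemma slowly_varying_small:
  fixes p \<Psi> :: "real \<Rightarrow> 'a::real_normed_vector"
  assumes p: "\<And>t. t \<ge> 0 \<Longrightarrow> (p has_vector_derivative p' t) (at t within {0..})"
    and p': "(p' \<longlongrightarrow> 0) at_top"
    and \<Psi>: "\<And>t. t \<ge> 0 \<Longrightarrow> (\<Psi> has_vector_derivative \<Psi>' t) (at t within {0..})"
    and \<Psi>_bound: "\<And>t. t \<ge> 0 \<Longrightarrow> norm (\<Psi> t) \<le> B"
    and close: "\<forall>\<^sub>F t in at_top. norm (\<Psi>' t + p t) \<le> e"
    and e: "e > 0"
  shows "\<forall>\<^sub>F t in at_top. norm (p t) \<le> 2 * e"
proof -
  have B: "B \<ge> 0" using order_trans[OF norm_ge_zero \<Psi>_bound[of 0]] by simp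
  \<comment> \<open>The window is so long that the increment of \<open>\<Psi>\<close>, at most
    \<open>2 * B\<close>, costs only e/2 per unit of time; the 1 keeps L positive when B = 0.
    Together with e from \<open>close\<close> and e/2 from the drift of p over the window, the total
    is \<open>2 * e\<close>.\<close>
  define L where "L = 4 * B / e + 1"
  have L: "L > 0" using B e by (auto simp: L_def intro!: add_nonneg_pos)
  have LB: "2 * B \<le> L * (e / 2)" using e by (simp add: L_def field_simps)
  have "\<forall>\<^sub>F t in at_top. norm (p' t) < e / (2 * L)"
    using p' e L by (auto simp: tendsto_iff dist_norm)
  with close have "\<forall>\<^sub>F t in at_top. norm (p' t) < e / (2 * L) \<and> norm (\<Psi>' t + p t) \<le> e"
    by eventually_elim auto
  then obtain t0 where t0: "\<And>t. t \<ge> t0 \<Longrightarrow> norm (p' t) \<le> e / (2 * L)"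
    "\<And>t. t \<ge> t0 \<Longrightarrow> norm (\<Psi>' t + p t) \<le> e"
    by (auto simp: eventually_at_top_linorder) (meson less_imp_le)
  have "norm (p t) \<le> 2 * e" if t: "t \<ge> max t0 0" for t
  proof -
    have sub: "{t..t + L} \<subseteq> {0..}" using t by auto
    have slow: "norm (p t - p s) \<le> e / 2" if s: "s \<in> {t..t + L}" for s
    proof -
      have "norm (p t - p s) \<le> e / (2 * L) * \<bar>t - s\<bar>"
        by (rule has_vector_derivative_bound[of "{t..t + L}" p p'])
          (use t s sub t0 L in \<open>auto intro: has_vector_derivative_within_subset[OF p]\<close>)
      also have "\<dots> \<le> e / (2 * L) * L" using s e L by (intro mult_left_mono) auto
      finally show ?thesis using L by simp
    qed
    define q where "q s = \<Psi> s + (s - t) *\<^sub>R p t" for s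
    have "norm (q (t + L) - q t) \<le> (e + e / 2) * \<bar>(t + L) - t\<bar>"
    proof (rule has_vector_derivative_bound[of "{t..t + L}"])
      fix s assume s: "s \<in> {t..t + L}"
      have "(\<Psi> has_vector_derivative \<Psi>' s) (at s within {t..t + L})"
        using s t by (intro has_vector_derivative_within_subset[OF \<Psi> sub]) auto
      then show "(q has_vector_derivative (\<Psi>' s + p t)) (at s within {t..t + L})"
        unfolding q_def by (auto intro!: derivative_eq_intros)
      have "norm (\<Psi>' s + p t) \<le> norm (\<Psi>' s + p s) + norm (p t - p s)"
        using norm_triangle_ineq[of "\<Psi>' s + p s" "p t - p s"] by simp
      then show "norm (\<Psi>' s + p t) \<le> e + e / 2" using t0(2)[of s] slow[OF s] s t by simp
    qed (use L in auto)
    moreover have "q (t + L) - q t = (\<Psi> (t + L) - \<Psi> t) + L *\<^sub>R p t" by (simp add: q_def)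
    moreover have "norm (\<Psi> (t + L) - \<Psi> t) \<le> 2 * B"
      using norm_triangle_ineq4[of "\<Psi> (t + L)" "\<Psi> t"] \<Psi>_bound[of t] \<Psi>_bound[of "t + L"] t L
      by simp
    moreover have "L * norm (p t) \<le> norm ((\<Psi> (t + L) - \<Psi> t) + L *\<^sub>R p t) + norm (\<Psi> (t + L) - \<Psi> t)"
      using norm_triangle_ineq4[of "(\<Psi> (t + L) - \<Psi> t) + L *\<^sub>R p t" "\<Psi> (t + L) - \<Psi> t"] L by simp
    ultimately have "L * norm (p t) \<le> (e + e / 2) * \<bar>(t + L) - t\<bar> + L * (e / 2)"
      using LB by simp
    also have "(e + e / 2) * \<bar>(t + L) - t\<bar> = L * (e + e / 2)" using L by simp
    finally have "L * norm (p t) \<le> L * (e + e / 2) + L * (e / 2)" .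
    also have "\<dots> = L * (2 * e)" by (simp add: algebra_simps)
    finally show ?thesis using L by simp
  qed
  then show ?thesis by (intro eventually_mono[OF eventually_ge_at_top])
qed

text \<open>Multiplying the output by \<open>cis (\<omega> j * t)\<close> makes the \<open>j\<close>-th mode slowly varying while every
  other mode keeps oscillating, hence has a bounded antiderivative.\<close>

lemma oscillator_mode_tendsto_0:
  fixes \<xi> \<eta> d :: "nat \<Rightarrow> real \<Rightarrow> real" and a \<omega> :: "nat \<Rightarrow> real"
  assumes \<xi>: "\<And>k t. t \<ge> 0 \<Longrightarrow> (\<xi> k has_vector_derivative (\<omega> k * \<eta> k t - d k t)) (at t within {0..})"
    and \<eta>: "\<And>k t. t \<ge> 0 \<Longrightarrow> (\<eta> k has_vector_derivative (- \<omega> k * \<xi> k t)) (at t within {0..})"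
    and d: "\<And>k. (d k \<longlongrightarrow> 0) at_top"
    and bound: "\<And>k t. t \<ge> 0 \<Longrightarrow> norm (Complex (\<xi> k t) (\<eta> k t)) \<le> R"
    and pos: "\<And>k. \<omega> k > 0" and inj: "inj \<omega>"
    and output_small: "\<And>e. e > 0 \<Longrightarrow> \<exists>N0. \<forall>N\<ge>N0. \<forall>\<^sub>F t in at_top. \<bar>\<Sum>k<N. a k * \<xi> k t\<bar> \<le> e"
    and a: "a j \<noteq> 0"
  shows "((\<lambda>t. Complex (\<xi> j t) (\<eta> j t)) \<longlongrightarrow> 0) at_top"
proof -
  define \<zeta> where "\<zeta> k t = Complex (\<xi> k t) (\<eta> k t)" for k t
  define u where "u t = exp (\<i> * of_real (\<omega> j) * of_real t)" for t
  have norm_u: "norm (u t) = 1" for t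
    unfolding u_def using norm_exp_i_times[of "\<omega> j * t"] by (simp add: mult.assoc)
  have u: "(u has_vector_derivative \<i> * of_real (\<omega> j) * u t) (at t within S)" for t S
    unfolding u_def
    by (auto intro!: derivative_eq_intros has_vector_derivative_real_field simp: mult_ac)
  have \<zeta>: "(\<zeta> k has_vector_derivative (- \<i> * of_real (\<omega> k) * \<zeta> k t - of_real (d k t))) (at t within {0..})"
    and cnj_\<zeta>: "((\<lambda>t. cnj (\<zeta> k t)) has_vector_derivative
        (\<i> * of_real (\<omega> k) * cnj (\<zeta> k t) - of_real (d k t))) (at t within {0..})"
    if "t \<ge> 0" for k t
  proof -
    show "(\<zeta> k has_vector_derivative (- \<i> * of_real (\<omega> k) * \<zeta> k t - of_real (d k t))) (at t within {0..})"
      unfolding has_vector_derivative_complex_iff \<zeta>_def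
      using \<xi>[OF that, of k] \<eta>[OF that, of k]
      by (simp add: has_real_derivative_iff_has_vector_derivative)
    then show "((\<lambda>t. cnj (\<zeta> k t)) has_vector_derivative
        (\<i> * of_real (\<omega> k) * cnj (\<zeta> k t) - of_real (d k t))) (at t within {0..})"
      by (rule has_vector_derivative_cnj[THEN has_vector_derivative_eq_rhs]) simp
  qed
  \<comment> \<open>Since \<xi>_j is half the sum of \<zeta>_j and its conjugate, this is the
    nonoscillating part of the j-th output term times u. In its derivative the two rotations cancel
    and only the decaying feedback remains.\<close>
  define p where "p t = of_real (a j / 2) * (\<zeta> j t * u t)" for t
  define p' where "p' t = - of_real (a j / 2) * (of_real (d j t) * u t)" for t
  have p: "(p has_vector_derivative p' t) (at t within {0..})" if "t \<ge> 0" for t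
    unfolding p_def p'_def
    by (rule has_vector_derivative_eq_rhs,
        rule has_vector_derivative_mult_right[OF has_vector_derivative_mult[OF \<zeta>[OF that] u]])
      (simp add: algebra_simps)
  have p'_lim: "(p' \<longlongrightarrow> 0) at_top"
  proof (rule tendsto_norm_zero_cancel)
    have "((\<lambda>t. \<bar>a j / 2\<bar> * \<bar>d j t\<bar>) \<longlongrightarrow> \<bar>a j / 2\<bar> * \<bar>0\<bar>) at_top"
      by (intro tendsto_intros d)
    then show "((\<lambda>t. norm (p' t)) \<longlongrightarrow> 0) at_top"
      by (simp add: p'_def norm_mult norm_u)
  qed
  \<comment> \<open>\<open>\<alpha> j = 0\<close> because the denominator vanishes: the resonant mode gets no antiderivative.\<close>
  define \<alpha> where "\<alpha> k = 1 / (\<i> * of_real (\<omega> j - \<omega> k))" for k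
  define \<beta> where "\<beta> k = 1 / (\<i> * of_real (\<omega> j + \<omega> k))" for k
  \<comment> \<open>Apart from the feedback, \<open>\<zeta> k t * u t\<close> and
    \<open>cnj (\<zeta> k t) * u t\<close> rotate with frequencies \<omega>_j - \<omega>_k and
    \<omega>_j + \<omega>_k. Dividing by i times these frequencies integrates the two halves of
    \<xi>_k u; the contribution of \<open>d k\<close> is collected in \<open>r k\<close>.\<close>
  define \<psi> where "\<psi> k t = 1 / 2 * (\<alpha> k * (\<zeta> k t * u t) + \<beta> k * (cnj (\<zeta> k t) * u t))" for k t
  define r where "r k t = 1 / 2 * ((\<alpha> k + \<beta> k) * (of_real (d k t) * u t))" for k t
  have \<alpha>: "\<alpha> k * (\<i> * of_real (\<omega> j - \<omega> k)) = (if k = j then 0 else 1)" for k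
    using inj by (auto simp: \<alpha>_def inj_eq)
  have \<beta>: "\<beta> k * (\<i> * of_real (\<omega> j + \<omega> k)) = 1" for k
    using pos[of j] pos[of k] by (simp add: \<beta>_def flip: of_real_add)
  have \<psi>: "(\<psi> k has_vector_derivative
      (of_real (\<xi> k t) * u t - (if k = j then 1 / 2 * (\<zeta> j t * u t) else 0) - r k t)) (at t within {0..})"
    if "t \<ge> 0" for k t
    unfolding \<psi>_def
  proof (rule has_vector_derivative_eq_rhs, rule has_vector_derivative_mult_right[OF
        has_vector_derivative_add[OF
          has_vector_derivative_mult_right[OF has_vector_derivative_mult[OF \<zeta>[OF that] u]]
          has_vector_derivative_mult_right[OF has_vector_derivative_mult[OF cnj_\<zeta>[OF that] u]]]])
    let ?Z = "\<zeta> k t" and ?D = "of_real (d k t)"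
    let ?l = "1 / 2 * (\<alpha> k * (?Z * (\<i> * of_real (\<omega> j) * u t) + (- \<i> * of_real (\<omega> k) * ?Z - ?D) * u t) +
       \<beta> k * (cnj ?Z * (\<i> * of_real (\<omega> j) * u t) + (\<i> * of_real (\<omega> k) * cnj ?Z - ?D) * u t))"
    have "?l = 1 / 2 * ((\<alpha> k * (\<i> * of_real (\<omega> j - \<omega> k))) * (?Z * u t)
        + (\<beta> k * (\<i> * of_real (\<omega> j + \<omega> k))) * (cnj ?Z * u t)) - r k t"
      by (simp add: r_def algebra_simps)
    also have "\<dots> = 1 / 2 * ((if k = j then 0 else 1) * (?Z * u t) + 1 * (cnj ?Z * u t)) - r k t"
      by (simp only: \<alpha> \<beta>)
    also have "\<dots> = 1 / 2 * (?Z + cnj ?Z) * u t - (if k = j then 1 / 2 * (\<zeta> j t * u t) else 0) - r k t"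
      by (simp add: algebra_simps)
    also have "1 / 2 * (?Z + cnj ?Z) = of_real (\<xi> k t)"
      by (simp add: complex_add_cnj \<zeta>_def)
    finally show "?l = of_real (\<xi> k t) * u t - (if k = j then 1 / 2 * (\<zeta> j t * u t) else 0) - r k t" .
  qed
  have "\<forall>\<^sub>F t in at_top. norm (p t) \<le> 4 * e" if e: "e > 0" for e
  proof -
    obtain N0 where N0: "\<And>N. N \<ge> N0 \<Longrightarrow> \<forall>\<^sub>F t in at_top. \<bar>\<Sum>k<N. a k * \<xi> k t\<bar> \<le> e"
      using output_small[OF e] by blast
    \<comment> \<open>The cut must be late enough for the output estimate and must retain the mode
      j.\<close>
    define N where "N = max N0 (Suc j)"
    have jN: "j < N" by (simp add: N_def)
    define \<Psi> where "\<Psi> t = (\<Sum>k<N. of_real (a k) * \<psi> k t)" for t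
    define rr where "rr t = (\<Sum>k<N. of_real (a k) * r k t)" for t
    \<comment> \<open>Thus \<open>\<Psi>' t + p t\<close> is the truncated output times u minus a
      decaying remainder: each is eventually at most e, and \<open>slowly_varying_small\<close>
      doubles the resulting \<open>2 * e\<close>.\<close>
    define \<Psi>' where "\<Psi>' t = of_real (\<Sum>k<N. a k * \<xi> k t) * u t - p t - rr t" for t
    have deriv: "(\<Psi> has_vector_derivative \<Psi>' t) (at t within {0..})" if "t \<ge> 0" for t
    proof -
      have "(\<Psi> has_vector_derivative (\<Sum>k<N. of_real (a k) *
          (of_real (\<xi> k t) * u t - (if k = j then 1 / 2 * (\<zeta> j t * u t) else 0) - r k t))) (at t within {0..})"
        unfolding \<Psi>_def
        by (intro has_vector_derivative_sum has_vector_derivative_mult_right \<psi> that)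
      also have "(\<Sum>k<N. of_real (a k) *
          (of_real (\<xi> k t) * u t - (if k = j then 1 / 2 * (\<zeta> j t * u t) else 0) - r k t))
        = (\<Sum>k<N. of_real (a k * \<xi> k t) * u t - (if k = j then p t else 0) - of_real (a k) * r k t)"
        by (intro sum.cong) (auto simp: p_def algebra_simps)
      also have "\<dots> = \<Psi>' t"
        using jN by (simp add: \<Psi>'_def rr_def sum_subtractf sum_distrib_right)
      finally show ?thesis .
    qed
    define B where "B = (\<Sum>k<N. \<bar>a k\<bar> * (1 / 2 * (norm (\<alpha> k) * R + norm (\<beta> k) * R)))"
    have "norm (\<Psi> t) \<le> B" if "t \<ge> 0" for t
    proof -
      have "norm (\<psi> k t) \<le> 1 / 2 * (norm (\<alpha> k) * R + norm (\<beta> k) * R)" for k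
      proof -
        have "norm (\<alpha> k * (\<zeta> k t * u t) + \<beta> k * (cnj (\<zeta> k t) * u t))
            \<le> norm (\<alpha> k * (\<zeta> k t * u t)) + norm (\<beta> k * (cnj (\<zeta> k t) * u t))"
          by (rule norm_triangle_ineq)
        also have "\<dots> \<le> norm (\<alpha> k) * R + norm (\<beta> k) * R"
          using bound[OF that, of k]
          by (auto simp: norm_mult norm_u \<zeta>_def intro!: add_mono mult_left_mono)
        finally show ?thesis by (simp add: \<psi>_def norm_mult norm_divide)
      qed
      then have "norm (of_real (a k) * \<psi> k t) \<le> \<bar>a k\<bar> * (1 / 2 * (norm (\<alpha> k) * R + norm (\<beta> k) * R))" for k
        unfolding norm_mult by (intro mult_mono) auto
      then show ?thesis unfolding \<Psi>_def B_def by (intro sum_norm_le) auto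
    qed
    moreover have "\<forall>\<^sub>F t in at_top. norm (\<Psi>' t + p t) \<le> 2 * e"
    proof -
      have "(rr \<longlongrightarrow> 0) at_top"
      proof -
        have "((\<lambda>t. r k t) \<longlongrightarrow> 0) at_top" for k
        proof (rule tendsto_norm_zero_cancel)
          have "((\<lambda>t. 1 / 2 * (norm (\<alpha> k + \<beta> k) * \<bar>d k t\<bar>)) \<longlongrightarrow> 1 / 2 * (norm (\<alpha> k + \<beta> k) * \<bar>0\<bar>)) at_top"
            by (intro tendsto_intros d)
          then show "((\<lambda>t. norm (r k t)) \<longlongrightarrow> 0) at_top"
            by (simp add: r_def norm_mult norm_divide norm_u)
        qed
        then have "(rr \<longlongrightarrow> (\<Sum>k<N. of_real (a k) * 0)) at_top"
          unfolding rr_def by (intro tendsto_intros)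
        then show ?thesis by simp
      qed
      then have "\<forall>\<^sub>F t in at_top. norm (rr t) < e"
        using e by (auto simp: tendsto_iff)
      moreover have "\<forall>\<^sub>F t in at_top. \<bar>\<Sum>k<N. a k * \<xi> k t\<bar> \<le> e"
        by (rule N0) (simp add: N_def)
      ultimately show ?thesis
      proof eventually_elim
        case (elim t)
        have "norm (\<Psi>' t + p t) \<le> norm (of_real (\<Sum>k<N. a k * \<xi> k t) * u t) + norm (rr t)"
          unfolding \<Psi>'_def by (simp add: norm_triangle_ineq4)
        also have "norm (of_real (\<Sum>k<N. a k * \<xi> k t) * u t) = \<bar>\<Sum>k<N. a k * \<xi> k t\<bar>"
          by (simp only: norm_mult norm_u norm_of_real mult_1_right)
        finally show ?case using elim by linarith
      qed
    qed
    ultimately have "\<forall>\<^sub>F t in at_top. norm (p t) \<le> 2 * (2 * e)"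
      using e by (intro slowly_varying_small[OF p p'_lim deriv]) auto
    then show ?thesis by simp
  qed
  then have "(p \<longlongrightarrow> 0) at_top"
  proof (intro tendstoI)
    fix e :: real assume "\<And>e. e > 0 \<Longrightarrow> \<forall>\<^sub>F t in at_top. norm (p t) \<le> 4 * e" "e > 0"
    from this(1)[of "e / 8"] this(2) have "\<forall>\<^sub>F t in at_top. norm (p t) \<le> e / 2" by simp
    then show "\<forall>\<^sub>F t in at_top. dist (p t) 0 < e"
      by eventually_elim (use \<open>e > 0\<close> in simp)
  qed
  then have "((\<lambda>t. norm (p t) / \<bar>a j / 2\<bar>) \<longlongrightarrow> 0 / \<bar>a j / 2\<bar>) at_top"
    using a by (intro tendsto_divide tendsto_norm_zero) auto
  then have "((\<lambda>t. norm (\<zeta> j t)) \<longlongrightarrow> 0) at_top"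
    using a by (simp add: p_def norm_mult norm_u norm_divide)
  then show ?thesis unfolding \<zeta>_def by (rule tendsto_norm_zero_cancel)
qed

section \<open>The error dynamics\<close>

definition trunc :: "nat \<Rightarrow> ell2 \<Rightarrow> ell2" where
  "trunc N x = Ell2 (\<lambda>j. if j < N then coord x j else 0)"

lemma coord_trunc [simp]: "coord (trunc N x) j = (if j < N then coord x j else 0)"
proof -
  have "summable (\<lambda>j. (if j < N then coord x j else 0)\<^sup>2)"
    by (rule summable_finite[of "{..<N}"]) auto
  then show ?thesis by (simp add: trunc_def coord_Ell2)
qed

lemma trunc_tendsto: "(\<lambda>N. trunc N x) \<longlonglongrightarrow> x"
proof -
  have "(\<lambda>N. (trunc N x, 0::ell2)) \<longlonglongrightarrow> (x, 0)"
  proof (rule state_tendsto_dominated)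
    fix j
    show "(\<lambda>N. coord (fst (trunc N x, 0::ell2)) j) \<longlonglongrightarrow> coord (fst (x, 0::ell2)) j"
      by (rule tendsto_eventually) (auto simp: eventually_sequentially intro!: exI[of _ "Suc j"])
    show "(coord (fst ((trunc N x, 0::ell2) - (x, 0))) j)\<^sup>2 + (coord (snd ((trunc N x, 0::ell2) - (x, 0))) j)\<^sup>2
        \<le> (coord x j)\<^sup>2" for N
      by simp
  qed (simp_all add: summable_coord_sq)
  from tendsto_fst[OF this] show ?thesis by simp
qed

lemma inner_trunc: "trunc N x \<bullet> y = (\<Sum>j<N. coord x j * coord y j)"
proof -
  have "(\<lambda>j. if j < N then coord x j * coord y j else 0) sums (\<Sum>j | j < N. coord x j * coord y j)"
    by (rule sums_If_finite) simp
  then have "(\<Sum>j. if j < N then coord x j * coord y j else 0) = (\<Sum>j<N. coord x j * coord y j)"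
    by (simp add: sums_iff lessThan_def)
  then show ?thesis
    unfolding inner_ell2_def by (simp add: if_distrib[of "\<lambda>a. a * _"] cong: if_cong)
qed

lemma dom_A_dense: "closure (dom_A \<omega>) = UNIV"
proof -
  have "z \<in> closure (dom_A \<omega>)" for z
  proof (rule closure_sequential[THEN iffD2], intro exI conjI allI)
    show "(trunc N (fst z), trunc N (snd z)) \<in> dom_A \<omega>" for N
      unfolding dom_A_def by (auto intro!: summable_finite[of "{..<N}"] split: if_splits)
    have "(\<lambda>N. (trunc N (fst z), trunc N (snd z))) \<longlonglongrightarrow> (fst z, snd z)"
      by (intro tendsto_Pair trunc_tendsto)
    then show "(\<lambda>N. (trunc N (fst z), trunc N (snd z))) \<longlonglongrightarrow> z" by simp
  qed
  then show ?thesis by blast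
qed

lemma inner_op_A:
  assumes "z \<in> dom_A \<omega>"
  shows "z \<bullet> op_A \<omega> z = 0"
proof -
  have "z \<bullet> op_A \<omega> z = (\<Sum>j. coord (fst z) j * coord (fst (op_A \<omega> z)) j
      + coord (snd z) j * coord (snd (op_A \<omega> z)) j)"
    using inner_state[of "fst z" "snd z" "fst (op_A \<omega> z)" "snd (op_A \<omega> z)"] by simp
  then show ?thesis by (simp add: coord_op_A[OF assms] mult_ac)
qed

section \<open>The feedback as a bounded operator of finite rank\<close>

lemma coord_sum: "coord (\<Sum>s\<in>S. f s) j = (\<Sum>s\<in>S. coord (f s) j)"
  by (rule linear_sum[OF bounded_linear.linear[OF bounded_linear_coord]])

text \<open>The Riesz representative of the output s: \<open>op_C c z $ s\<close> is its inner
  product with z.\<close>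

definition output_vec :: "('r::finite \<Rightarrow> nat \<Rightarrow> real) \<Rightarrow> 'r \<Rightarrow> state" where
  "output_vec c s = (Ell2 (c s), 0)"

text \<open>The operator F C in symmetric form. The gains \<open>\<gamma> s * c s j\<close> make F
  the adjoint of C weighted by \<open>\<gamma>\<close>, which is why its quadratic form is a
  weighted sum of squared outputs.\<close>

definition feedback :: "('r::finite \<Rightarrow> nat \<Rightarrow> real) \<Rightarrow> ('r \<Rightarrow> real) \<Rightarrow> state \<Rightarrow> state" where
  "feedback c \<gamma> z = (\<Sum>s\<in>UNIV. (\<gamma> s * (output_vec c s \<bullet> z)) *\<^sub>R output_vec c s)"

lemma error_op_eq:
  assumes c: "\<And>s. summable (\<lambda>j. (c s j)\<^sup>2)"
  shows "error_op \<omega> c (\<lambda>j s. \<gamma> s * c s j) (\<lambda>j s. 0) z = op_A \<omega> z - feedback c \<gamma> z"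
proof -
  have C: "op_C c z $ s = output_vec c s \<bullet> z" for s
    by (simp add: op_C_def op_C1_def output_vec_def case_prod_beta inner_prod_def inner_ell2_def
        coord_Ell2[OF c])
  have "op_F (\<lambda>j s. \<gamma> s * c s j) (\<lambda>j s. 0) (op_C c z) = feedback c \<gamma> z"
  proof (rule state_eqI)
    fix j
    have "coord (fst (op_F (\<lambda>j s. \<gamma> s * c s j) (\<lambda>j s. 0) (op_C c z))) j
        = (\<Sum>s\<in>UNIV. \<gamma> s * c s j * (output_vec c s \<bullet> z))"
      by (simp add: op_F_def coord_comb summable_scale_sq c C)
    also have "\<dots> = coord (fst (feedback c \<gamma> z)) j"
      by (simp add: feedback_def fst_sum coord_sum, simp add: output_vec_def coord_Ell2[OF c] mult_ac)
    finally show "coord (fst (op_F (\<lambda>j s. \<gamma> s * c s j) (\<lambda>j s. 0) (op_C c z))) j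
        = coord (fst (feedback c \<gamma> z)) j" .
    show "coord (snd (op_F (\<lambda>j s. \<gamma> s * c s j) (\<lambda>j s. 0) (op_C c z))) j
        = coord (snd (feedback c \<gamma> z)) j"
      by (simp add: op_F_def coord_comb feedback_def snd_sum coord_sum output_vec_def)
  qed
  then show ?thesis by (simp add: error_op_def)
qed

lemma linear_feedback: "linear (feedback c \<gamma>)"
  by (rule linearI)
    (simp_all add: feedback_def inner_add_right distrib_left scaleR_add_left sum.distrib
      scaleR_sum_right mult_ac)

lemma feedback_bound: "\<exists>K>0. \<forall>z. norm (feedback c \<gamma> z) \<le> K * norm z"
proof -
  define K where "K = (\<Sum>s\<in>UNIV. \<bar>\<gamma> s\<bar> * (norm (output_vec c s))\<^sup>2)"
  have "norm (feedback c \<gamma> z) \<le> K * norm z" for z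
    unfolding feedback_def K_def sum_distrib_right
  proof (rule sum_norm_le)
    fix s
    have "\<bar>output_vec c s \<bullet> z\<bar> \<le> norm (output_vec c s) * norm z" by (rule Cauchy_Schwarz_ineq2)
    then have "\<bar>\<gamma> s\<bar> * \<bar>output_vec c s \<bullet> z\<bar> * norm (output_vec c s)
        \<le> \<bar>\<gamma> s\<bar> * (norm (output_vec c s) * norm z) * norm (output_vec c s)"
      by (intro mult_right_mono mult_left_mono) auto
    then show "norm ((\<gamma> s * (output_vec c s \<bullet> z)) *\<^sub>R output_vec c s)
        \<le> \<bar>\<gamma> s\<bar> * (norm (output_vec c s))\<^sup>2 * norm z"
      by (simp add: abs_mult power2_eq_square mult_ac)
  qed
  \<comment> \<open>\<open>K\<close> is 0 when all outputs vanish, whereas the perturbation argument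
    takes a positive constant.\<close>
  then have "norm (feedback c \<gamma> z) \<le> (\<bar>K\<bar> + 1) * norm z" for z
    by (rule order_trans) (intro mult_right_mono; simp)
  then show ?thesis by (intro exI[of _ "\<bar>K\<bar> + 1"]) auto
qed

lemma inner_feedback: "z \<bullet> feedback c \<gamma> z = (\<Sum>s\<in>UNIV. \<gamma> s * (output_vec c s \<bullet> z)\<^sup>2)"
  by (simp add: feedback_def inner_sum_right inner_commute[of z] power2_eq_square mult_ac)

theorem error_semigroup_exists:
  assumes c: "\<And>s. summable (\<lambda>j. (c s j)\<^sup>2)"
  shows "\<exists>T. generates (dom_A \<omega>) (error_op \<omega> c (\<lambda>j s. \<gamma> s * c s j) (\<lambda>j s. 0)) T"
proof -
  obtain K where K: "K > 0" "\<And>z. norm (feedback c \<gamma> z) \<le> K * norm z"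
    using feedback_bound by blast
  interpret perturbed_isometry_group "rotation \<omega>" "\<lambda>z. - feedback c \<gamma> z" K
    using K linear_compose_neg[OF linear_feedback]
    by (intro perturbed_isometry_group.intro isometry_group_rotation perturbed_isometry_group_axioms.intro)
      auto
  have "error_op \<omega> c (\<lambda>j s. \<gamma> s * c s j) (\<lambda>j s. 0) = (\<lambda>z. op_A \<omega> z + - feedback c \<gamma> z)"
    by (simp add: error_op_eq[OF c] fun_eq_iff)
  then show ?thesis using generates_perturbed[OF generates_rotation[of \<omega>]] by auto
qed

text \<open>Since \<open>\<omega> N\<close> bounds all later frequencies from below, the graph norm controls the tail.\<close>

lemma norm_sq_le_head_plus_tail:
  assumes z: "z \<in> dom_A \<omega>" and mono: "mono \<omega>" and pos: "\<omega> N > 0"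
  shows "(norm z)\<^sup>2 \<le> (\<Sum>j<N. (coord (fst z) j)\<^sup>2 + (coord (snd z) j)\<^sup>2)
    + (norm (op_A \<omega> z))\<^sup>2 / (\<omega> N)\<^sup>2"
proof -
  define g where "g j = (coord (fst z) j)\<^sup>2 + (coord (snd z) j)\<^sup>2" for j
  have g: "g j \<ge> 0" for j by (simp add: g_def)
  have head: "(\<lambda>j. if j < N then g j else 0) sums (\<Sum>j<N. g j)"
    using sums_If_finite[of "\<lambda>j. j < N" g] by (simp add: lessThan_def)
  have Az: "(norm (op_A \<omega> z))\<^sup>2 = (\<Sum>j. (\<omega> j)\<^sup>2 * g j)"
    by (simp add: norm_state_sq coord_op_A[OF z] power_mult_distrib g_def distrib_left add.commute)
  have "summable (\<lambda>j. (\<omega> j)\<^sup>2 * g j)" using z by (simp add: dom_A_def g_def case_prod_beta)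
  then have "(\<lambda>j. (\<omega> j)\<^sup>2 * g j) sums (norm (op_A \<omega> z))\<^sup>2" unfolding Az by (rule summable_sums)
  then have tail: "(\<lambda>j. (\<omega> j)\<^sup>2 * g j / (\<omega> N)\<^sup>2) sums ((norm (op_A \<omega> z))\<^sup>2 / (\<omega> N)\<^sup>2)"
    by (rule sums_divide)
  have le: "g j \<le> (if j < N then g j else 0) + (\<omega> j)\<^sup>2 * g j / (\<omega> N)\<^sup>2" for j
  proof (cases "j < N")
    case False
    then have "\<omega> N \<le> \<omega> j" using monoD[OF mono] by simp
    then have "(\<omega> N)\<^sup>2 \<le> (\<omega> j)\<^sup>2" using pos by (intro power_mono) auto
    then have "g j * (\<omega> N)\<^sup>2 \<le> g j * (\<omega> j)\<^sup>2" using g by (rule mult_left_mono)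
    then show ?thesis using pos False by (simp add: pos_le_divide_eq mult.commute)
  qed (use g in simp)
  have "(norm z)\<^sup>2 = (\<Sum>j. g j)" by (simp add: norm_state_sq g_def)
  also have "\<dots> \<le> (\<Sum>j<N. g j) + (norm (op_A \<omega> z))\<^sup>2 / (\<omega> N)\<^sup>2"
    using sums_le[OF le summable_sums sums_add[OF head tail]] summable_state_sq[of z]
    by (simp add: g_def)
  finally show ?thesis by (simp add: g_def)
qed

section \<open>Energy decay and stability for an arbitrary semigroup with the given
  generator\<close>

locale error_semigroup =
  fixes \<omega> :: "nat \<Rightarrow> real" and c :: "'r::finite \<Rightarrow> nat \<Rightarrow> real" and \<gamma> :: "'r \<Rightarrow> real"
    and T :: "real \<Rightarrow> state \<Rightarrow> state"
  assumes \<omega>_pos: "\<omega> j > 0" and \<omega>_mono: "strict_mono \<omega>" and \<omega>_lim: "filterlim \<omega> at_top sequentially"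
    and c_sq: "summable (\<lambda>j. (c s j)\<^sup>2)" and \<gamma>_pos: "\<gamma> s > 0" and observable: "\<exists>s. c s j \<noteq> 0"
    and generates_T: "generates (dom_A \<omega>) (error_op \<omega> c (\<lambda>j s. \<gamma> s * c s j) (\<lambda>j s. 0)) T"
begin

abbreviation G :: "state \<Rightarrow> state" where
  "G \<equiv> error_op \<omega> c (\<lambda>j s. \<gamma> s * c s j) (\<lambda>j s. 0)"

abbreviation b :: "'r \<Rightarrow> state" where "b \<equiv> output_vec c"

lemma G_eq: "G z = op_A \<omega> z - feedback c \<gamma> z"
  by (rule error_op_eq[OF c_sq])

lemma C0_T: "C0_semigroup T"
  using generates_T by (simp add: generates_def)

lemmas T_invariant = generates_invariant[OF generates_T]
  and T_derivative = generates_orbit_derivative[OF generates_T]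

lemma inner_G:
  assumes "z \<in> dom_A \<omega>"
  shows "z \<bullet> G z = - (\<Sum>s\<in>UNIV. \<gamma> s * (b s \<bullet> z)\<^sup>2)"
  by (simp add: G_eq inner_diff_right inner_op_A[OF assms] inner_feedback)

lemma energy_derivative:
  assumes x: "x \<in> dom_A \<omega>" and t: "t \<ge> 0"
  shows "((\<lambda>t. (norm (T t x))\<^sup>2) has_real_derivative - 2 * (\<Sum>s\<in>UNIV. \<gamma> s * (b s \<bullet> T t x)\<^sup>2))
    (at t within {0..})"
proof -
  have "((\<lambda>t. T t x \<bullet> T t x) has_derivative (\<lambda>h. T t x \<bullet> (h *\<^sub>R G (T t x)) + (h *\<^sub>R G (T t x)) \<bullet> T t x))
      (at t within {0..})"
    using T_derivative[OF x t] unfolding has_vector_derivative_def by (intro has_derivative_inner)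
  also have "(\<lambda>h. T t x \<bullet> (h *\<^sub>R G (T t x)) + (h *\<^sub>R G (T t x)) \<bullet> T t x)
      = (*) (- 2 * (\<Sum>s\<in>UNIV. \<gamma> s * (b s \<bullet> T t x)\<^sup>2))"
    by (simp add: inner_G[OF T_invariant(1)[OF x t]] inner_commute[of "G _"] fun_eq_iff)
  finally show ?thesis unfolding has_field_derivative_def power2_norm_eq_inner .
qed

lemma contraction_on_domain:
  assumes x: "x \<in> dom_A \<omega>" and t: "t \<ge> 0"
  shows "norm (T t x) \<le> norm x"
proof (cases "t = 0")
  case False
  have "\<exists>\<xi>\<in>{0<..<t}. (norm (T t x))\<^sup>2 - (norm (T 0 x))\<^sup>2
      = - 2 * (\<Sum>s\<in>UNIV. \<gamma> s * (b s \<bullet> T \<xi> x)\<^sup>2) * (t - 0)"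
  proof (rule mvt_simple)
    fix r assume "0 \<le> r" "r \<le> t"
    then have "((\<lambda>t. (norm (T t x))\<^sup>2) has_real_derivative - 2 * (\<Sum>s\<in>UNIV. \<gamma> s * (b s \<bullet> T r x)\<^sup>2))
        (at r within {0..t})"
      by (intro DERIV_subset[OF energy_derivative[OF x]]) auto
    then show "((\<lambda>t. (norm (T t x))\<^sup>2) has_derivative (*) (- 2 * (\<Sum>s\<in>UNIV. \<gamma> s * (b s \<bullet> T r x)\<^sup>2)))
        (at r within {0..t})"
      by (simp add: has_field_derivative_def)
  qed (use t False in simp)
  then obtain \<xi> where "(norm (T t x))\<^sup>2 - (norm x)\<^sup>2
      = - 2 * ((\<Sum>s\<in>UNIV. \<gamma> s * (b s \<bullet> T \<xi> x)\<^sup>2) * t)"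
    by (auto simp: C0_semigroupD(2)[OF C0_T])
  moreover have "(\<Sum>s\<in>UNIV. \<gamma> s * (b s \<bullet> T \<xi> x)\<^sup>2) * t \<ge> 0"
    using t \<gamma>_pos by (intro mult_nonneg_nonneg sum_nonneg) (auto intro: less_imp_le)
  ultimately have "(norm (T t x))\<^sup>2 \<le> (norm x)\<^sup>2" by linarith
  then show ?thesis by (rule power2_le_imp_le) simp
qed (simp add: C0_semigroupD(2)[OF C0_T])

text \<open>The energy identity is available only on the domain; for fixed t the inequality defines
  a closed set, and the domain is dense.\<close>

lemma contraction:
  assumes t: "t \<ge> 0"
  shows "norm (T t x) \<le> norm x"
proof -
  have "continuous_on UNIV (T t)"
    using C0_semigroupD(1)[OF C0_T t] linear_continuous_on by blast
  then have "closed {x. norm (T t x) \<le> norm x}"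
    by (intro closed_Collect_le continuous_intros)
  then have "closure (dom_A \<omega>) \<subseteq> {x. norm (T t x) \<le> norm x}"
    using contraction_on_domain[OF _ t] by (intro closure_minimal) auto
  then show ?thesis by (auto simp: dom_A_dense)
qed

lemma output_tendsto_0:
  assumes x: "x \<in> dom_A \<omega>"
  shows "((\<lambda>t. b s \<bullet> T t x) \<longlongrightarrow> 0) at_top"
proof (rule dissipated_output_tendsto_0)
  show "((\<lambda>t. (norm (T t x))\<^sup>2) has_real_derivative - 2 * (\<Sum>s\<in>UNIV. \<gamma> s * (b s \<bullet> T t x)\<^sup>2))
    (at t within {0..})" if "t \<ge> 0" for t
    by (rule energy_derivative[OF x that])
  show "- 2 * (\<Sum>s\<in>UNIV. \<gamma> s * (b s \<bullet> T t x)\<^sup>2) \<le> - (2 * \<gamma> s) * (b s \<bullet> T t x)\<^sup>2" for t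
    using member_le_sum[of s UNIV "\<lambda>s. \<gamma> s * (b s \<bullet> T t x)\<^sup>2"] \<gamma>_pos
    by (simp add: less_imp_le)
  show "2 * \<gamma> s > 0" using \<gamma>_pos by simp
  fix r t :: real assume r: "r \<ge> 0" and t: "t \<ge> 0"
  \<comment> \<open>The speed of the orbit is the norm of \<open>G (T t x) = T t (G x)\<close>,
    which contractivity bounds by \<open>norm (G x)\<close>; this makes the output
    Lipschitz.\<close>
  have "norm (T r x - T t x) \<le> norm (G x) * \<bar>r - t\<bar>"
  proof (rule has_vector_derivative_bound[of "{0..}"])
    show "norm (G (T t x)) \<le> norm (G x)" if "t \<in> {0..}" for t
      using that contraction T_invariant(2)[OF x] by simp
  qed (use T_derivative[OF x] r t in auto)
  then have "norm (b s) * norm (T r x - T t x) \<le> norm (b s) * (norm (G x) * \<bar>r - t\<bar>)"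
    by (intro mult_left_mono) auto
  then show "\<bar>b s \<bullet> T r x - b s \<bullet> T t x\<bar> \<le> norm (b s) * norm (G x) * \<bar>r - t\<bar>"
    using Cauchy_Schwarz_ineq2[of "b s" "T r x - T t x"] by (simp add: inner_diff_right mult.assoc)
qed simp

lemma modes_tendsto_0:
  assumes x: "x \<in> dom_A \<omega>"
  shows "((\<lambda>t. Complex (coord (fst (T t x)) j) (coord (snd (T t x)) j)) \<longlongrightarrow> 0) at_top"
proof -
  obtain s where s: "c s j \<noteq> 0" using observable by blast
  \<comment> \<open>The coupling between the modes. It enters only the first component, and each of
    its coordinates is a finite combination of outputs, hence decays.\<close>
  define d where "d k t = coord (fst (feedback c \<gamma> (T t x))) k" for k t
  show ?thesis
  proof (rule oscillator_mode_tendsto_0[where \<omega> = \<omega> and d = d and R = "norm x" and a = "c s"])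
    fix k t assume t: "t \<ge> (0::real)"
    have deriv: "((\<lambda>t. coord (fst (T t x)) k) has_vector_derivative coord (fst (G (T t x))) k) (at t within {0..})"
      "((\<lambda>t. coord (snd (T t x)) k) has_vector_derivative coord (snd (G (T t x))) k) (at t within {0..})"
      using bounded_linear.has_vector_derivative[OF bounded_linear_compose[OF bounded_linear_coord bounded_linear_fst]
          T_derivative[OF x t]]
        bounded_linear.has_vector_derivative[OF bounded_linear_compose[OF bounded_linear_coord bounded_linear_snd]
          T_derivative[OF x t]]
      by simp_all
    have "coord (snd (feedback c \<gamma> z)) k = 0" for z
      by (simp add: feedback_def snd_sum coord_sum output_vec_def)
    with deriv show "((\<lambda>t. coord (fst (T t x)) k) has_vector_derivative
        (\<omega> k * coord (snd (T t x)) k - d k t)) (at t within {0..})"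
      "((\<lambda>t. coord (snd (T t x)) k) has_vector_derivative
        (- \<omega> k * coord (fst (T t x)) k)) (at t within {0..})"
      by (simp_all add: G_eq coord_op_A[OF T_invariant(1)[OF x t]] d_def)
    have "(norm (Complex (coord (fst (T t x)) k) (coord (snd (T t x)) k)))\<^sup>2
        \<le> (norm (fst (T t x)))\<^sup>2 + (norm (snd (T t x)))\<^sup>2"
      using abs_coord_le[of "fst (T t x)" k] abs_coord_le[of "snd (T t x)" k]
      by (auto simp: cmod_power2 intro!: add_mono intro: power2_le_iff_abs_le[THEN iffD2])
    also have "\<dots> = (norm (T t x))\<^sup>2" by (simp add: norm_prod_def)
    finally have "norm (Complex (coord (fst (T t x)) k) (coord (snd (T t x)) k)) \<le> norm (T t x)"
      by (rule power2_le_imp_le) simp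
    then show "norm (Complex (coord (fst (T t x)) k) (coord (snd (T t x)) k)) \<le> norm x"
      using contraction[OF t, of x] by linarith
  next
    fix k
    have "((\<lambda>t. \<Sum>s\<in>UNIV. \<gamma> s * (b s \<bullet> T t x) * coord (fst (b s)) k)
        \<longlongrightarrow> (\<Sum>s\<in>UNIV. \<gamma> s * 0 * coord (fst (b s)) k)) at_top"
      by (intro tendsto_intros output_tendsto_0[OF x])
    then show "(d k \<longlongrightarrow> 0) at_top"
      by (simp add: d_def[abs_def] feedback_def fst_sum coord_sum)
  next
    fix e :: real assume e: "e > 0"
    \<comment> \<open>The truncated output differs from the true one by the inner product of
      \<open>trunc N v - v\<close> with the first component of the orbit. By contractivity q bounds
      that component at all times t >= 0, so one N0 serves all of them.\<close>
    define v where "v = Ell2 (c s)"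
    have v: "coord v k = c s k" for k by (simp add: v_def coord_Ell2[OF c_sq])
    define q where "q = norm x + 1"
    have q: "q > 0" using norm_ge_zero[of x] unfolding q_def by linarith
    have "\<forall>\<^sub>F N in sequentially. dist (trunc N v) v < e / (2 * q)"
      using trunc_tendsto[of v] e q by (simp add: tendsto_iff)
    then obtain N0 where N0: "\<And>N. N \<ge> N0 \<Longrightarrow> norm (trunc N v - v) \<le> e / (2 * q)"
      by (auto simp: eventually_sequentially dist_norm) (meson less_imp_le)
    have "\<forall>\<^sub>F t in at_top. \<bar>\<Sum>k<N. c s k * coord (fst (T t x)) k\<bar> \<le> e" if N: "N \<ge> N0" for N
    proof -
      have "\<forall>\<^sub>F t in at_top. \<bar>b s \<bullet> T t x\<bar> < e / 2"
        using output_tendsto_0[OF x, of s] e by (auto simp: tendsto_iff dest!: spec[of _ "e / 2"])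
      then show ?thesis
        using eventually_ge_at_top[of 0]
      proof eventually_elim
        case (elim t)
        have "(\<Sum>k<N. c s k * coord (fst (T t x)) k) = (trunc N v - v) \<bullet> fst (T t x) + b s \<bullet> T t x"
          by (simp add: inner_diff_left inner_trunc v output_vec_def inner_prod_def flip: v_def)
        moreover have "\<bar>(trunc N v - v) \<bullet> fst (T t x)\<bar> \<le> e / 2"
        proof -
          have "norm (fst (T t x)) \<le> q"
            using norm_fst_le[of "fst (T t x)" "snd (T t x)"] contraction[OF elim(2), of x] by (simp add: q_def)
          then have "norm (trunc N v - v) * norm (fst (T t x)) \<le> e / (2 * q) * q"
            using N0[OF N] e q by (intro mult_mono) auto
          also have "\<dots> = e / 2"
            using q by simp
          finally show ?thesis
            using Cauchy_Schwarz_ineq2[of "trunc N v - v" "fst (T t x)"] by linarith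
        qed
        ultimately show ?case using elim(1) by linarith
      qed
    qed
    then show "\<exists>N0. \<forall>N\<ge>N0. \<forall>\<^sub>F t in at_top. \<bar>\<Sum>k<N. c s k * coord (fst (T t x)) k\<bar> \<le> e"
      by blast
  qed (use \<omega>_pos \<omega>_mono s in \<open>auto simp: strict_mono_imp_inj_on\<close>)
qed

lemma orbit_tendsto_0_on_domain:
  assumes x: "x \<in> dom_A \<omega>"
  shows "((\<lambda>t. T t x) \<longlongrightarrow> 0) at_top"
proof (rule tendsto_norm_zero_cancel, rule tendstoI)
  fix e :: real assume e: "e > 0"
  obtain K where K: "K > 0" "\<And>z. norm (feedback c \<gamma> z) \<le> K * norm z"
    using feedback_bound by blast
  \<comment> \<open>Along the orbit A is G plus the feedback: the first part is bounded by
    \<open>norm (G x)\<close> by commutation and contractivity, the second by K times the norm of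
    the state.\<close>
  define Q where "Q = norm (G x) + K * norm x"
  have A: "norm (op_A \<omega> (T t x)) \<le> Q" if t: "t \<ge> 0" for t
  proof -
    have "op_A \<omega> (T t x) = T t (G x) + feedback c \<gamma> (T t x)"
      using T_invariant(2)[OF x t] by (simp add: G_eq diff_eq_eq)
    then have "norm (op_A \<omega> (T t x)) \<le> norm (T t (G x)) + norm (feedback c \<gamma> (T t x))"
      by (simp add: norm_triangle_ineq)
    also have "\<dots> \<le> norm (G x) + K * norm x"
      using contraction[OF t] order_trans[OF K(2) mult_left_mono[OF contraction[OF t]]] K(1)
      by (intro add_mono) auto
    finally show ?thesis by (simp add: Q_def)
  qed
  \<comment> \<open>N is chosen before t, so that the tail contributes at most (e/2)^2 at all times
    t >= 0; only the finitely many modes below N then have to decay.\<close>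
  have "\<forall>\<^sub>F N in sequentially. \<omega> N > 2 * \<bar>Q\<bar> / e"
    using \<omega>_lim by (simp add: filterlim_at_top_dense)
  then obtain N where N: "\<omega> N > 2 * \<bar>Q\<bar> / e" by (auto simp: eventually_sequentially)
  have tail: "Q\<^sup>2 / (\<omega> N)\<^sup>2 \<le> (e / 2)\<^sup>2"
  proof -
    have "\<bar>Q / \<omega> N\<bar> \<le> \<bar>e / 2\<bar>" using N e \<omega>_pos[of N] by (simp add: abs_mult field_simps)
    then show ?thesis by (simp only: abs_le_square_iff power_divide)
  qed
  have "((\<lambda>t. \<Sum>j<N. (norm (Complex (coord (fst (T t x)) j) (coord (snd (T t x)) j)))\<^sup>2)
      \<longlongrightarrow> (\<Sum>j<N. (norm (0::complex))\<^sup>2)) at_top"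
    by (intro tendsto_intros modes_tendsto_0[OF x])
  then have head: "((\<lambda>t. \<Sum>j<N. (coord (fst (T t x)) j)\<^sup>2 + (coord (snd (T t x)) j)\<^sup>2) \<longlongrightarrow> 0) at_top"
    by (simp add: cmod_power2)
  have "\<forall>\<^sub>F t in at_top. (\<Sum>j<N. (coord (fst (T t x)) j)\<^sup>2 + (coord (snd (T t x)) j)\<^sup>2) < (e / 2)\<^sup>2"
    using order_tendstoD(2)[OF head, of "(e / 2)\<^sup>2"] e by simp
  then show "\<forall>\<^sub>F t in at_top. dist (norm (T t x)) 0 < e"
    using eventually_ge_at_top[of 0]
  proof eventually_elim
    case (elim t)
    have "(norm (T t x))\<^sup>2 \<le> (\<Sum>j<N. (coord (fst (T t x)) j)\<^sup>2 + (coord (snd (T t x)) j)\<^sup>2)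
        + (norm (op_A \<omega> (T t x)))\<^sup>2 / (\<omega> N)\<^sup>2"
      by (rule norm_sq_le_head_plus_tail[OF T_invariant(1)[OF x elim(2)] strict_mono_mono[OF \<omega>_mono] \<omega>_pos])
    also have "(norm (op_A \<omega> (T t x)))\<^sup>2 / (\<omega> N)\<^sup>2 \<le> Q\<^sup>2 / (\<omega> N)\<^sup>2"
      using A[OF elim(2)] by (intro divide_right_mono power_mono) auto
    finally have "(norm (T t x))\<^sup>2 < (e / 2)\<^sup>2 + (e / 2)\<^sup>2" using elim(1) tail by linarith
    also have "\<dots> \<le> e\<^sup>2" using e by (simp add: power2_eq_square)
    finally have "norm (T t x) < e" by (rule power_less_imp_less_base) (use e in simp)
    then show ?case by simp
  qed
qed

theorem asymptotically_stable_T: "asymptotically_stable T"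
  unfolding asymptotically_stable_def lyapunov_stable_def
proof (intro conjI allI impI)
  fix \<epsilon> :: real assume "\<epsilon> > 0"
  then show "\<exists>\<delta>>0. \<forall>x. norm x < \<delta> \<longrightarrow> (\<forall>t\<ge>0. norm (T t x) < \<epsilon>)"
    using contraction by (meson le_less_trans)
next
  fix x
  show "((\<lambda>t. norm (T t x)) \<longlongrightarrow> 0) at_top"
  proof (rule tendstoI)
    fix e :: real assume e: "e > 0"
    have "x \<in> closure (dom_A \<omega>)" by (simp add: dom_A_dense)
    then obtain w where w: "w \<in> dom_A \<omega>" "norm (x - w) < e / 2"
      using e by (auto simp: closure_approachable dist_norm norm_minus_commute
          dest!: spec[of _ "e / 2"])
    have "\<forall>\<^sub>F t in at_top. norm (T t w) < e / 2"
      using orbit_tendsto_0_on_domain[OF w(1)] e by (auto simp: tendsto_iff dest!: spec[of _ "e / 2"])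
    then show "\<forall>\<^sub>F t in at_top. dist (norm (T t x)) 0 < e"
      using eventually_ge_at_top[of 0]
    proof eventually_elim
      case (elim t)
      interpret bounded_linear "T t" by (rule C0_semigroupD(1)[OF C0_T elim(2)])
      have "norm (T t x) \<le> norm (T t w) + norm (T t (x - w))"
        using norm_triangle_ineq[of "T t w" "T t (x - w)"] by (simp add: diff)
      then show ?case using elim(1) contraction[OF elim(2), of "x - w"] w(2) by simp
    qed
  qed
qed

end

theorem theorem2:
  fixes \<rho> E I m \<kappa> l l\<^sub>0 :: real
    and \<omega> :: "nat \<Rightarrow> real"
    and c :: "'r::finite \<Rightarrow> nat \<Rightarrow> real"
    and \<gamma> :: "'r \<Rightarrow> real"
  assumes "\<rho> > 0" and "E > 0" and "I > 0" and "m > 0" and "\<kappa> > 0" and "l > 0"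
    and "0 < l\<^sub>0" and "l\<^sub>0 < l"
    and "strict_mono \<omega>"
    and "range \<omega> = {w. w > 0 \<and> char_fun \<rho> E I m \<kappa> l l\<^sub>0 w = 0}"
    and "\<And>s. summable (\<lambda>j. (c s j)\<^sup>2)"
    and "\<And>s. \<gamma> s > 0"
    and "\<And>j. \<exists>s. c s j \<noteq> 0"
  shows "(\<exists>T. generates (dom_A \<omega>) (error_op \<omega> c (\<lambda>j s. \<gamma> s * c s j) (\<lambda>j s. 0)) T) \<and>
    (\<forall>T. generates (dom_A \<omega>) (error_op \<omega> c (\<lambda>j s. \<gamma> s * c s j) (\<lambda>j s. 0)) T
      \<longrightarrow> asymptotically_stable T)"
proof -
  let ?G = "error_op \<omega> c (\<lambda>j s. \<gamma> s * c s j) (\<lambda>j s. 0)"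
  have "asymptotically_stable T" if "generates (dom_A \<omega>) ?G T" for T
  proof -
    have "\<omega> j > 0" for j using assms(10) by blast
    moreover have "filterlim \<omega> at_top sequentially"
      by (rule char_fun_zeros_at_top[OF assms(1-9) eq_refl[OF assms(10)]])
    ultimately interpret error_semigroup \<omega> c \<gamma> T
      using assms(9,11-13) that by unfold_locales
    show ?thesis by (rule asymptotically_stable_T)
  qed
  then show ?thesis using error_semigroup_exists[where c = c, OF assms(11)] by blast
qed

end
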